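(* Let $G=H\rtimes F$ be a semidirect product where $H=\langle X\rangle$ is a finite group and $F=\langle Y\rangle\cong\mathbb{Z}$, with $X\subseteq H$ and $Y\subseteq F$ finite symmetric generating sets, and suppose the Cayley graph $\Gamma(H,X)$ contains a Hamilton cycle. Then the Cayley graph $\Gamma(G,X\cup Y)$ has a Hamilton circle.
   Context: Generating sets are symmetric ($s\in S\Rightarrow s^{-1}\in S$). For a locally finite graph $\Gamma$, $|\Gamma|$ denotes its Freudenthal compactification (the graph together with its ends). A Hamilton circle of $\Gamma$ is a subspace of $|\Gamma|$ homeomorphic to $S^1$ containing every vertex of $\Gamma$. *)

theory Defs
  imports "HOL-Analysis.Analysis" "HOL-Algebra.Elementary_Groups"
begin

record 'v ugraph =
  verts :: "'v set"
  edges :: "'v set set"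

(* Right Cayley graph as a simple graph: an identity element in S would only give loops,
   which are discarded. *)
definition cayley_graph :: "('g, 'm) monoid_scheme \<Rightarrow> 'g set \<Rightarrow> 'g ugraph" where
  "cayley_graph G S =
    \<lparr>verts = carrier G,
     edges = {{g, g \<otimes>\<^bsub>G\<^esub> s} | g s. g \<in> carrier G \<and> s \<in> S \<and> g \<otimes>\<^bsub>G\<^esub> s \<noteq> g}\<rparr>"

definition symmetric_generating_set :: "('g, 'm) monoid_scheme \<Rightarrow> 'g set \<Rightarrow> bool" where
  "symmetric_generating_set G S \<longleftrightarrow>
     S \<subseteq> carrier G \<and> (\<forall>s\<in>S. inv\<^bsub>G\<^esub> s \<in> S) \<and> generate G S = carrier G"

(* Internal semidirect product; the left factor H is the normal one. *)
definition semidirect_product :: "('g, 'm) monoid_scheme \<Rightarrow> 'g set \<Rightarrow> 'g set \<Rightarrow> bool" where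
  "semidirect_product G H F \<longleftrightarrow>
     H \<lhd> G \<and> subgroup F G \<and> H <#>\<^bsub>G\<^esub> F = carrier G \<and> H \<inter> F = {\<one>\<^bsub>G\<^esub>}"

definition hamilton_cycle :: "'v ugraph \<Rightarrow> 'v list \<Rightarrow> bool" where
  "hamilton_cycle \<Gamma> c \<longleftrightarrow>
     3 \<le> length c \<and> distinct c \<and> set c = verts \<Gamma> \<and>
     (\<forall>i<length c. {c ! i, c ! (Suc i mod length c)} \<in> edges \<Gamma>)"

definition rays :: "'v ugraph \<Rightarrow> (nat \<Rightarrow> 'v) set" where
  "rays \<Gamma> = {r. inj r \<and> range r \<subseteq> verts \<Gamma> \<and> (\<forall>n. {r n, r (Suc n)} \<in> edges \<Gamma>)}"

definition connected_avoiding :: "'v ugraph \<Rightarrow> 'v set \<Rightarrow> ('v \<times> 'v) set" where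
  "connected_avoiding \<Gamma> S =
     {(u, v). u \<in> verts \<Gamma> - S \<and> v \<in> verts \<Gamma> - S \<and>
        (u, v) \<in> {(x, y). x \<in> verts \<Gamma> - S \<and> y \<in> verts \<Gamma> - S \<and> {x, y} \<in> edges \<Gamma>}\<^sup>*}"

(* Two rays are equivalent if no finite set S of vertices separates them, that is, both have
   a tail in the same component of the graph minus S. *)
definition ray_equiv :: "'v ugraph \<Rightarrow> ((nat \<Rightarrow> 'v) \<times> (nat \<Rightarrow> 'v)) set" where
  "ray_equiv \<Gamma> =
     {(r, q). r \<in> rays \<Gamma> \<and> q \<in> rays \<Gamma> \<and>
        (\<forall>S. finite S \<and> S \<subseteq> verts \<Gamma> \<longrightarrow>
           (\<exists>N. \<forall>m\<ge>N. \<forall>n\<ge>N. (r m, q n) \<in> connected_avoiding \<Gamma> S))}"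

definition graph_ends :: "'v ugraph \<Rightarrow> (nat \<Rightarrow> 'v) set set" where
  "graph_ends \<Gamma> = rays \<Gamma> // ray_equiv \<Gamma>"

(* C(S, w): the component of the graph minus S in which every ray of the end w has a tail. *)
definition end_component :: "'v ugraph \<Rightarrow> 'v set \<Rightarrow> (nat \<Rightarrow> 'v) set \<Rightarrow> 'v set" where
  "end_component \<Gamma> S \<omega> =
     {v. \<exists>r\<in>\<omega>. \<exists>N. \<forall>n\<ge>N. (v, r n) \<in> connected_avoiding \<Gamma> S}"

(* Points of the 1-complex are given by barycentric coordinates, so that
   edge_point u v t = edge_point v u (1 - t) is the point of the edge uv at distance t from u. *)
definition vertex_point :: "'v \<Rightarrow> 'v \<Rightarrow> real" where
  "vertex_point v = indicator {v}"

definition edge_point :: "'v \<Rightarrow> 'v \<Rightarrow> real \<Rightarrow> 'v \<Rightarrow> real" where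
  "edge_point u v t = (\<lambda>x. (1 - t) * vertex_point u x + t * vertex_point v x)"

definition complex_points :: "'v ugraph \<Rightarrow> ('v \<Rightarrow> real) set" where
  "complex_points \<Gamma> =
     vertex_point ` verts \<Gamma> \<union> {edge_point u v t | u v t. {u, v} \<in> edges \<Gamma> \<and> 0 \<le> t \<and> t \<le> 1}"

(* The quotient topology of the disjoint union of the edges, each a copy of [0,1]. *)
definition complex_open :: "'v ugraph \<Rightarrow> ('v \<Rightarrow> real) set \<Rightarrow> bool" where
  "complex_open \<Gamma> U \<longleftrightarrow>
     U \<subseteq> complex_points \<Gamma> \<and>
     (\<forall>u v. {u, v} \<in> edges \<Gamma> \<longrightarrow>
        openin (top_of_set {0..1}) {t \<in> {0..1}. edge_point u v t \<in> U})"

datatype 'v freudenthal_point = Complex_Point "'v \<Rightarrow> real" | End_Point "(nat \<Rightarrow> 'v) set"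

(* Basic neighbourhood of the end w: the component C(S, w), all ends living in it, and the inner
   points of the edges between S and C(S, w) at distance less than e from C(S, w). *)
definition end_neighbourhood ::
    "'v ugraph \<Rightarrow> 'v set \<Rightarrow> (nat \<Rightarrow> 'v) set \<Rightarrow> real \<Rightarrow> 'v freudenthal_point set" where
  "end_neighbourhood \<Gamma> S \<omega> \<epsilon> =
     (let C = end_component \<Gamma> S \<omega> in
        Complex_Point ` (vertex_point ` C \<union>
          {edge_point u v t | u v t. u \<in> C \<and> v \<in> C \<and> {u, v} \<in> edges \<Gamma> \<and> 0 < t \<and> t < 1} \<union>
          {edge_point u v t | u v t. u \<in> C \<and> v \<in> S \<and> {u, v} \<in> edges \<Gamma> \<and> 0 < t \<and> t < 1 \<and> t < \<epsilon>}) \<union>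
        End_Point ` {\<omega>' \<in> graph_ends \<Gamma>. end_component \<Gamma> S \<omega>' = C})"

(* For locally finite connected graphs this is the Freudenthal compactification. *)
definition freudenthal :: "'v ugraph \<Rightarrow> 'v freudenthal_point topology" where
  "freudenthal \<Gamma> = topology_generated_by
     ({Complex_Point ` U | U. complex_open \<Gamma> U} \<union>
      {end_neighbourhood \<Gamma> S \<omega> \<epsilon> | S \<omega> \<epsilon>.
         finite S \<and> S \<subseteq> verts \<Gamma> \<and> \<omega> \<in> graph_ends \<Gamma> \<and> 0 < \<epsilon>})"

definition hamilton_circle :: "'v ugraph \<Rightarrow> 'v freudenthal_point set \<Rightarrow> bool" where
  "hamilton_circle \<Gamma> C \<longleftrightarrow>
     C \<subseteq> topspace (freudenthal \<Gamma>) \<and>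
     subtopology (freudenthal \<Gamma>) C homeomorphic_space top_of_set (sphere (0::complex) 1) \<and>
     (\<forall>v\<in>verts \<Gamma>. Complex_Point (vertex_point v) \<in> C)"

lemma topspace_freudenthal:
  "topspace (freudenthal \<Gamma>) = Complex_Point ` complex_points \<Gamma> \<union> End_Point ` graph_ends \<Gamma>"
  (is "?L = ?R")
proof
  have comp: "end_component \<Gamma> S \<omega> \<subseteq> verts \<Gamma>" for S \<omega>
    by (auto simp: end_component_def connected_avoiding_def)
  have "end_neighbourhood \<Gamma> S \<omega> \<epsilon> \<subseteq> ?R" for S \<omega> \<epsilon>
  proof -
    have "edge_point u v t \<in> complex_points \<Gamma>" if "{u, v} \<in> edges \<Gamma>" "0 < t" "t < 1" for u v t
      unfolding complex_points_def using that less_imp_le[of 0 t] less_imp_le[of t 1] by blast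
    moreover have "vertex_point v \<in> complex_points \<Gamma>" if "v \<in> end_component \<Gamma> S \<omega>" for v
      unfolding complex_points_def using that comp[of S \<omega>] by blast
    ultimately show ?thesis
      unfolding end_neighbourhood_def Let_def by blast
  qed
  moreover have "Complex_Point ` U \<subseteq> ?R" if "complex_open \<Gamma> U" for U
    using that unfolding complex_open_def by blast
  ultimately show "?L \<subseteq> ?R"
    unfolding freudenthal_def topology_generated_by_topspace by blast
  have "complex_open \<Gamma> (complex_points \<Gamma>)"
  proof -
    have "{t \<in> {0..1}. edge_point u v t \<in> complex_points \<Gamma>} = {0..1}" if "{u, v} \<in> edges \<Gamma>" for u v
      using that unfolding complex_points_def by fastforce
    then show ?thesis by (simp add: complex_open_def)
  qed
  then have "Complex_Point ` complex_points \<Gamma> \<subseteq> ?L"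
    unfolding freudenthal_def topology_generated_by_topspace by blast
  moreover have "End_Point \<omega> \<in> ?L" if "\<omega> \<in> graph_ends \<Gamma>" for \<omega>
  proof -
    have "End_Point \<omega> \<in> end_neighbourhood \<Gamma> {} \<omega> 1"
      using that by (simp add: end_neighbourhood_def Let_def)
    moreover have "finite {}" "{} \<subseteq> verts \<Gamma>" "(0::real) < 1" by simp_all
    ultimately show ?thesis
      unfolding freudenthal_def topology_generated_by_topspace using that by blast
  qed
  ultimately show "?R \<subseteq> ?L" by blast
qed

end

theory Submission
  imports Defs
begin

text \<open>Write \<open>g = f h\<close> with \<open>f\<close> in \<open>F\<close> and \<open>h\<close> in \<open>H\<close>. The cosets \<open>f H\<close> are finite layers, each spanned by
  a Hamilton cycle, and right multiplication by a generator \<open>y\<close> in \<open>Y\<close> matches the layer \<open>f H\<close>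
  perfectly with \<open>f y H\<close>. The Cayley graph of the integers with respect to \<open>Y\<close> has a Hamilton double
  ray, so the layers can be arranged in a sequence indexed by the integers, with a perfect matching
  between consecutive ones. Two disjoint double rays traverse this sequence together: in each layer
  they enter at distinct vertices \<open>x\<close> and \<open>y\<close>, one follows the cycle from \<open>x\<close> to the predecessor of
  \<open>y\<close> and the other from \<open>y\<close> to the predecessor of \<open>x\<close>, and both cross to the next layer there.
  They cover all vertices and converge to the same two ends, so that together with these ends they
  form a circle.\<close>

section \<open>Components and the topology at the ends\<close>

text \<open>The circle is compact and the compactification is Hausdorff, so a continuous injection
  of the circle is already an embedding; the topological work is the Hausdorff property together
  with continuity at the two points sent to ends. These ends have to be distinct. The layers are not
  traversed in the order of their integers, because the Hamilton double ray of \<open>Y\<close>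
  jumps back and forth; it stays within bounded distance of the identity, though, and this keeps its
  two sides apart. That double ray comes from a Hamilton path through the residues modulo some
  positive element a of \<open>Y\<close>, lifted to the integers and repeated with shifts by a. The
  path itself grows one generator at a time. The pair of rays has no natural starting layer. Because
  each matching is a bijection, the rule that yields the next pair of entry points can be inverted,
  and any two distinct entry points in layer 0 extend in both directions.\<close>

lemma sym_connected_avoiding: "sym (connected_avoiding \<Gamma> S)"
proof -
  have "sym {(x, y). x \<in> verts \<Gamma> - S \<and> y \<in> verts \<Gamma> - S \<and> {x, y} \<in> edges \<Gamma>}"
    by (auto simp: sym_def insert_commute)
  from symD[OF sym_rtrancl[OF this]] show ?thesis
    unfolding connected_avoiding_def by (intro symI) blast
qed

lemma connected_avoiding_sym:
  "(u, v) \<in> connected_avoiding \<Gamma> S \<Longrightarrow> (v, u) \<in> connected_avoiding \<Gamma> S"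
  using sym_connected_avoiding by (rule symD)

lemma connected_avoiding_trans:
  "(u, v) \<in> connected_avoiding \<Gamma> S \<Longrightarrow> (v, w) \<in> connected_avoiding \<Gamma> S \<Longrightarrow>
    (u, w) \<in> connected_avoiding \<Gamma> S"
  unfolding connected_avoiding_def by (clarsimp, erule rtrancl_trans)

lemma connected_avoiding_refl:
  "u \<in> verts \<Gamma> - S \<Longrightarrow> (u, u) \<in> connected_avoiding \<Gamma> S"
  unfolding connected_avoiding_def by auto

lemma connected_avoiding_edge:
  "u \<in> verts \<Gamma> - S \<Longrightarrow> v \<in> verts \<Gamma> - S \<Longrightarrow> {u, v} \<in> edges \<Gamma> \<Longrightarrow>
    (u, v) \<in> connected_avoiding \<Gamma> S"
  unfolding connected_avoiding_def by auto

text \<open>Serves to refute connectedness: a property that passes along every edge avoiding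
  \<open>S\<close> but fails at \<open>v\<close> rules out a path from \<open>u\<close>.\<close>

lemma connected_avoiding_invariant:
  assumes "(u, v) \<in> connected_avoiding \<Gamma> S" and "P u"
    and "\<And>x y. x \<in> verts \<Gamma> - S \<Longrightarrow> y \<in> verts \<Gamma> - S \<Longrightarrow> {x, y} \<in> edges \<Gamma> \<Longrightarrow> P x \<Longrightarrow> P y"
  shows "P v"
proof -
  have "(u, v) \<in> {(x, y). x \<in> verts \<Gamma> - S \<and> y \<in> verts \<Gamma> - S \<and> {x, y} \<in> edges \<Gamma>}\<^sup>*"
    using assms(1) unfolding connected_avoiding_def by blast
  then show ?thesis
    by (induction rule: rtrancl_induct) (use assms in auto)
qed

lemma end_component_subset: "end_component \<Gamma> S \<omega> \<subseteq> verts \<Gamma> - S"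
  by (auto simp: end_component_def connected_avoiding_def)

lemma end_component_closed:
  assumes "v \<in> end_component \<Gamma> S \<omega>" and "(v, w) \<in> connected_avoiding \<Gamma> S"
  shows "w \<in> end_component \<Gamma> S \<omega>"
  using assms connected_avoiding_trans[OF connected_avoiding_sym[OF assms(2)]]
  unfolding end_component_def by blast

lemma end_component_edge:
  assumes "u \<in> end_component \<Gamma> S \<omega>" and "{u, v} \<in> edges \<Gamma>" and "v \<in> verts \<Gamma> - S"
  shows "v \<in> end_component \<Gamma> S \<omega>"
proof -
  have "u \<in> verts \<Gamma> - S"
    using assms(1) by (rule subsetD[OF end_component_subset])
  from end_component_closed[OF assms(1) connected_avoiding_edge[OF this assms(3,2)]]
  show ?thesis .
qed

text \<open>\<open>end_component\<close> lets the ray range over the whole end. Equivalent rays have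
  tails in one component of the complement of \<open>S\<close>, so a single representative
  decides.\<close>

lemma end_component_class:
  assumes "(r, r) \<in> ray_equiv \<Gamma>" and "finite S" and "S \<subseteq> verts \<Gamma>"
  shows "end_component \<Gamma> S (ray_equiv \<Gamma> `` {r}) =
    {v. \<exists>N. \<forall>n\<ge>N. (v, r n) \<in> connected_avoiding \<Gamma> S}"
proof (intro equalityI subsetI)
  fix v assume "v \<in> end_component \<Gamma> S (ray_equiv \<Gamma> `` {r})"
  then obtain q N where q: "(r, q) \<in> ray_equiv \<Gamma>"
    and N: "\<forall>n\<ge>N. (v, q n) \<in> connected_avoiding \<Gamma> S"
    unfolding end_component_def by blast
  from q assms(2,3) obtain M where "\<forall>m\<ge>M. \<forall>n\<ge>M. (r m, q n) \<in> connected_avoiding \<Gamma> S"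
    unfolding ray_equiv_def by blast
  then have "(v, r m) \<in> connected_avoiding \<Gamma> S" if "m \<ge> M" for m
    using that N connected_avoiding_trans[of v "q (max M N)" \<Gamma> S "r m"]
      connected_avoiding_sym[of "r m" "q (max M N)" \<Gamma> S] by simp
  then show "v \<in> {v. \<exists>N. \<forall>n\<ge>N. (v, r n) \<in> connected_avoiding \<Gamma> S}" by blast
next
  fix v assume "v \<in> {v. \<exists>N. \<forall>n\<ge>N. (v, r n) \<in> connected_avoiding \<Gamma> S}"
  with assms(1) show "v \<in> end_component \<Gamma> S (ray_equiv \<Gamma> `` {r})"
    unfolding end_component_def by blast
qed

text \<open>An injective ray meets a finite set only finitely often, and beyond its last visit the
  ray itself is a path that avoids \<open>S\<close>.\<close>

lemma ray_equiv_refl: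
  assumes r: "r \<in> rays \<Gamma>"
  shows "(r, r) \<in> ray_equiv \<Gamma>"
proof -
  have "\<exists>N. \<forall>m\<ge>N. \<forall>n\<ge>N. (r m, r n) \<in> connected_avoiding \<Gamma> S"
    if S: "finite S" "S \<subseteq> verts \<Gamma>" for S
  proof -
    have inj: "inj r" and rv: "\<And>n. r n \<in> verts \<Gamma>" and re: "\<And>n. {r n, r (Suc n)} \<in> edges \<Gamma>"
      using r unfolding rays_def by auto
    have "finite (r -` S)"
      using inj S(1) by (simp add: finite_vimageI)
    then obtain N where N: "\<And>n. r n \<in> S \<Longrightarrow> n < N"
      by (metis finite_nat_iff_bounded vimageI2 lessThan_iff subsetD)
    have out: "r n \<in> verts \<Gamma> - S" if "n \<ge> N" for n
      using N[of n] rv that by fastforce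
    have conn: "(r N, r n) \<in> connected_avoiding \<Gamma> S" if "n \<ge> N" for n
      using that
    proof (induction n rule: dec_induct)
      case base
      show ?case by (rule connected_avoiding_refl[OF out]) simp
    next
      case (step n)
      then show ?case
        using connected_avoiding_trans[OF _ connected_avoiding_edge[OF out out re]] by simp
    qed
    then show ?thesis
      using connected_avoiding_trans[OF connected_avoiding_sym[OF conn] conn] by blast
  qed
  then show ?thesis
    using r unfolding ray_equiv_def by blast
qed

section \<open>Barycentric coordinates and open sets of the 1-complex\<close>

lemma vertex_point_apply: "vertex_point v x = (if x = v then 1 else 0)"
  by (simp add: vertex_point_def)

lemma edge_point_at_0 [simp]: "edge_point u v 0 = vertex_point u"
  and edge_point_at_1 [simp]: "edge_point u v 1 = vertex_point v"
  by (auto simp: edge_point_def)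

lemma edge_point_commute: "edge_point u v t = edge_point v u (1 - t)"
  by (auto simp: edge_point_def)

lemma edge_point_in_complex:
  "{u, v} \<in> edges \<Gamma> \<Longrightarrow> 0 \<le> t \<Longrightarrow> t \<le> 1 \<Longrightarrow> edge_point u v t \<in> complex_points \<Gamma>"
  unfolding complex_points_def by blast

lemma vertex_point_in_complex: "v \<in> verts \<Gamma> \<Longrightarrow> vertex_point v \<in> complex_points \<Gamma>"
  unfolding complex_points_def by blast

lemma continuous_on_edge_point: "continuous_on A (\<lambda>t. edge_point u v t x)"
  unfolding edge_point_def by (intro continuous_intros)

text \<open>Coordinates are affine on each edge, hence continuous. Finiteness of \<open>S\<close>
  keeps the intersection of the preimages open.\<close>

lemma complex_open_coordinates:
  assumes "open T" and "finite S"
  shows "complex_open \<Gamma> {p \<in> complex_points \<Gamma>. \<forall>v\<in>S. p v \<in> T}"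
  unfolding complex_open_def
proof (intro conjI allI impI)
  fix u v assume e: "{u, v} \<in> edges \<Gamma>"
  have "openin (top_of_set {0..1}) ({0..1} \<inter> (\<Inter>x\<in>S. (\<lambda>t. edge_point u v t x) -` T))"
  proof (rule openin_open_Int, rule open_INT[OF assms(2)], rule ballI)
    show "open ((\<lambda>t. edge_point u v t x) -` T)" for x
      by (rule open_vimage[OF assms(1) continuous_on_edge_point])
  qed
  moreover have "{t \<in> {0..1}. edge_point u v t \<in> {p \<in> complex_points \<Gamma>. \<forall>v\<in>S. p v \<in> T}} =
    {0..1} \<inter> (\<Inter>x\<in>S. (\<lambda>t. edge_point u v t x) -` T)"
    using edge_point_in_complex[OF e] by auto
  ultimately show "openin (top_of_set {0..1})
    {t \<in> {0..1}. edge_point u v t \<in> {p \<in> complex_points \<Gamma>. \<forall>v\<in>S. p v \<in> T}}" by simp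
qed auto

lemma complex_open_coordinate:
  assumes "open T"
  shows "complex_open \<Gamma> {p \<in> complex_points \<Gamma>. p v \<in> T}"
  using complex_open_coordinates[OF assms, of "{v}"] by simp

lemma complex_open_Union:
  assumes "\<And>U. U \<in> \<U> \<Longrightarrow> complex_open \<Gamma> U"
  shows "complex_open \<Gamma> (\<Union>\<U>)"
  unfolding complex_open_def
proof (intro conjI allI impI)
  show "\<Union>\<U> \<subseteq> complex_points \<Gamma>"
    using assms unfolding complex_open_def by blast
  fix u v assume "{u, v} \<in> edges \<Gamma>"
  then have "openin (top_of_set {0..1}) (\<Union>U\<in>\<U>. {t \<in> {0..1}. edge_point u v t \<in> U})"
    using assms unfolding complex_open_def by blast
  moreover have "{t \<in> {0..1}. edge_point u v t \<in> \<Union>\<U>} =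
    (\<Union>U\<in>\<U>. {t \<in> {0..1}. edge_point u v t \<in> U})" by auto
  ultimately show "openin (top_of_set {0..1}) {t \<in> {0..1}. edge_point u v t \<in> \<Union>\<U>}"
    by simp
qed

lemma complex_open_Int:
  assumes "complex_open \<Gamma> U" and "complex_open \<Gamma> V"
  shows "complex_open \<Gamma> (U \<inter> V)"
  unfolding complex_open_def
proof (intro conjI allI impI)
  show "U \<inter> V \<subseteq> complex_points \<Gamma>"
    using assms unfolding complex_open_def by blast
  fix u v assume "{u, v} \<in> edges \<Gamma>"
  then have "openin (top_of_set {0..1})
    ({t \<in> {0..1}. edge_point u v t \<in> U} \<inter> {t \<in> {0..1}. edge_point u v t \<in> V})"
    using assms unfolding complex_open_def by blast
  moreover have "{t \<in> {0..1}. edge_point u v t \<in> U \<inter> V} =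
    {t \<in> {0..1}. edge_point u v t \<in> U} \<inter> {t \<in> {0..1}. edge_point u v t \<in> V}" by auto
  ultimately show "openin (top_of_set {0..1}) {t \<in> {0..1}. edge_point u v t \<in> U \<inter> V}"
    by (simp only:)
qed

text \<open>The complex part of an end neighbourhood in terms of coordinates: on an edge from
  \<open>C\<close> to \<open>S\<close> the distance from \<open>C\<close> is the coordinate at the
  endpoint in \<open>S\<close>. Openness can then be read off from strict inequalities.\<close>

definition component_points :: "'v ugraph \<Rightarrow> 'v set \<Rightarrow> 'v set \<Rightarrow> real \<Rightarrow> ('v \<Rightarrow> real) set" where
  "component_points \<Gamma> S C \<epsilon> = {p \<in> complex_points \<Gamma>. (\<exists>x\<in>C. p x > 0) \<and> (\<forall>v\<in>S. p v < \<epsilon>)}"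

lemma complex_open_component_points:
  assumes "finite S"
  shows "complex_open \<Gamma> (component_points \<Gamma> S C \<epsilon>)"
proof -
  have "component_points \<Gamma> S C \<epsilon> = (\<Union>x\<in>C. {p \<in> complex_points \<Gamma>. p x \<in> {0<..}}) \<inter>
    {p \<in> complex_points \<Gamma>. \<forall>v\<in>S. p v \<in> {..<\<epsilon>}}"
    unfolding component_points_def by auto
  moreover have "complex_open \<Gamma> (\<Union>x\<in>C. {p \<in> complex_points \<Gamma>. p x \<in> {0<..}})"
    by (rule complex_open_Union, erule imageE, hypsubst,
        rule complex_open_coordinate[OF open_greaterThan])
  ultimately show ?thesis
    using complex_open_Int[OF _ complex_open_coordinates[OF open_lessThan assms]] by simp
qed

text \<open>Edges are plain sets, so \<open>{u, u}\<close> would be a degenerate edge. With it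
  excluded, \<open>edge_point u v t\<close> has the coordinates \<open>1 - t\<close> at
  \<open>u\<close> and \<open>t\<close> at \<open>v\<close>.\<close>

locale simple_ugraph =
  fixes \<Gamma> :: "'v ugraph"
  assumes edgeD: "{u, v} \<in> edges \<Gamma> \<Longrightarrow> u \<in> verts \<Gamma> \<and> v \<in> verts \<Gamma> \<and> u \<noteq> v"
begin

lemma complex_pointE:
  assumes "p \<in> complex_points \<Gamma>"
  obtains (vertex) v where "v \<in> verts \<Gamma>" "p = vertex_point v"
  | (edge) u v t where "{u, v} \<in> edges \<Gamma>" "0 < t" "t < 1" "p = edge_point u v t"
proof -
  consider (v) v where "v \<in> verts \<Gamma>" "p = vertex_point v"
    | (e) u v t where "{u, v} \<in> edges \<Gamma>" "0 \<le> t" "t \<le> 1" "p = edge_point u v t"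
    using assms unfolding complex_points_def by blast
  then show ?thesis
  proof cases
    case v
    then show ?thesis by (rule vertex)
  next
    case e
    then show ?thesis
      using edge[of u v t] vertex[of u] vertex[of v] edgeD[of u v]
      by (cases "t = 0"; cases "t = 1") auto
  qed
qed

text \<open>A point with positive weight at some \<open>x\<close> of the component is
  \<open>x\<close> or lies on an edge at \<open>x\<close>, whose other endpoint is again in the
  component or in \<open>S\<close>. Points inside the component have weight 0 on \<open>S\<close>,
  which is below \<open>\<epsilon>\<close>.\<close>

lemma end_neighbourhood_eq:
  assumes "0 < \<epsilon>"
  shows "end_neighbourhood \<Gamma> S \<omega> \<epsilon> =
    Complex_Point ` component_points \<Gamma> S (end_component \<Gamma> S \<omega>) \<epsilon> \<union>
    End_Point ` {\<omega>' \<in> graph_ends \<Gamma>. end_component \<Gamma> S \<omega>' = end_component \<Gamma> S \<omega>}"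
proof -
  define C where "C = end_component \<Gamma> S \<omega>"
  have CS: "C \<subseteq> verts \<Gamma> - S"
    unfolding C_def by (rule end_component_subset)
  have CE: "v \<in> C \<or> v \<in> S" if "u \<in> C" "{u, v} \<in> edges \<Gamma>" for u v
    using that end_component_edge edgeD unfolding C_def by fastforce
  let ?K = "vertex_point ` C \<union>
    {edge_point u v t | u v t. u \<in> C \<and> v \<in> C \<and> {u, v} \<in> edges \<Gamma> \<and> 0 < t \<and> t < 1} \<union>
    {edge_point u v t | u v t. u \<in> C \<and> v \<in> S \<and> {u, v} \<in> edges \<Gamma> \<and> 0 < t \<and> t < 1 \<and> t < \<epsilon>}"
  have "?K = component_points \<Gamma> S C \<epsilon>"
  proof (intro equalityI subsetI)
    fix p assume "p \<in> ?K"
    then consider (1) v where "v \<in> C" "p = vertex_point v"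
      | (2) u v t where "u \<in> C" "v \<in> C" "{u, v} \<in> edges \<Gamma>" "0 < t" "t < 1" "p = edge_point u v t"
      | (3) u v t where "u \<in> C" "v \<in> S" "{u, v} \<in> edges \<Gamma>" "0 < t" "t < 1" "t < \<epsilon>"
          "p = edge_point u v t"
      by blast
    then show "p \<in> component_points \<Gamma> S C \<epsilon>"
    proof cases
      case 1
      then have "p v > 0" "\<forall>w\<in>S. p w = 0"
        using CS by (auto simp: vertex_point_apply)
      moreover have "p \<in> complex_points \<Gamma>"
        using 1 CS vertex_point_in_complex[of v \<Gamma>] by auto
      ultimately show ?thesis
        using 1 assms unfolding component_points_def by auto
    next
      case 2
      then have "p u > 0" "\<forall>w\<in>S. p w = 0" "u \<noteq> v"
        using CS edgeD by (auto simp: edge_point_def vertex_point_apply)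
      then show ?thesis
        using 2 assms edge_point_in_complex[of u v \<Gamma> t] unfolding component_points_def by auto
    next
      case 3
      then have "p u > 0" "\<forall>w\<in>S. p w < \<epsilon>"
        using CS assms edgeD by (auto simp: edge_point_def vertex_point_apply)
      then show ?thesis
        using 3 edge_point_in_complex[of u v \<Gamma> t] unfolding component_points_def by auto
    qed
  next
    fix p assume "p \<in> component_points \<Gamma> S C \<epsilon>"
    then obtain x where p: "p \<in> complex_points \<Gamma>" "x \<in> C" "p x > 0" "\<forall>v\<in>S. p v < \<epsilon>"
      unfolding component_points_def by blast
    from p(1) show "p \<in> ?K"
    proof (cases rule: complex_pointE)
      case (vertex v)
      then show ?thesis
        using p by (auto simp: vertex_point_apply split: if_splits)
    next
      case (edge u v t)
      have key: "p \<in> ?K" if "{x, w} \<in> edges \<Gamma>" "0 < s" "s < 1" "p = edge_point x w s" for w s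
      proof (cases "w \<in> C")
        case True
        then show ?thesis using that p(2) by blast
      next
        case False
        then have w: "w \<in> S" using CE that(1) p(2) by blast
        have "x \<noteq> w" using that(1) edgeD by blast
        then have "p w = s"
          using that(4) by (simp add: edge_point_def vertex_point_def)
        then have "s < \<epsilon>" using p(4) w by auto
        then show ?thesis using that p(2) w by blast
      qed
      have "x = u \<or> x = v"
        using p(3) edge(4) by (auto simp: edge_point_def vertex_point_apply split: if_splits)
      then show ?thesis
        using key[of v t] key[of u "1 - t"] edge edge_point_commute[of u v t]
        by (auto simp: insert_commute)
    qed
  qed
  then show ?thesis
    unfolding end_neighbourhood_def Let_def C_def by simp
qed

end

section \<open>Ends as classes of rays, and their separation by finite sets\<close>

lemma ray_equivI:
  assumes "r \<in> rays \<Gamma>" and "q \<in> rays \<Gamma>"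
    and "\<And>S. finite S \<Longrightarrow> S \<subseteq> verts \<Gamma> \<Longrightarrow>
      \<exists>N. \<forall>m\<ge>N. \<forall>n\<ge>N. (r m, q n) \<in> connected_avoiding \<Gamma> S"
  shows "(r, q) \<in> ray_equiv \<Gamma>"
  using assms unfolding ray_equiv_def by simp

lemma ray_equiv_rays: "(r, q) \<in> ray_equiv \<Gamma> \<Longrightarrow> r \<in> rays \<Gamma> \<and> q \<in> rays \<Gamma>"
  unfolding ray_equiv_def by simp

lemma ray_equivD:
  assumes "(r, q) \<in> ray_equiv \<Gamma>" and "finite S" and "S \<subseteq> verts \<Gamma>"
  obtains N where "\<And>m n. m \<ge> N \<Longrightarrow> n \<ge> N \<Longrightarrow> (r m, q n) \<in> connected_avoiding \<Gamma> S"
proof -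
  have "\<exists>N. \<forall>m\<ge>N. \<forall>n\<ge>N. (r m, q n) \<in> connected_avoiding \<Gamma> S"
    using assms unfolding ray_equiv_def by simp
  then show ?thesis using that by auto
qed

lemma ray_equiv_sym:
  assumes rq: "(r, q) \<in> ray_equiv \<Gamma>"
  shows "(q, r) \<in> ray_equiv \<Gamma>"
proof -
  have "\<exists>N. \<forall>m\<ge>N. \<forall>n\<ge>N. (q m, r n) \<in> connected_avoiding \<Gamma> S"
    if S: "finite S" "S \<subseteq> verts \<Gamma>" for S
  proof -
    obtain N where "\<And>m n. m \<ge> N \<Longrightarrow> n \<ge> N \<Longrightarrow> (r m, q n) \<in> connected_avoiding \<Gamma> S"
      by (rule ray_equivD[OF rq S]) blast
    then show ?thesis
      by (meson connected_avoiding_sym)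
  qed
  then show ?thesis
    using ray_equiv_rays[OF rq] by (intro ray_equivI) simp_all
qed

lemma ray_equiv_trans:
  assumes rq: "(r, q) \<in> ray_equiv \<Gamma>" and qp: "(q, p) \<in> ray_equiv \<Gamma>"
  shows "(r, p) \<in> ray_equiv \<Gamma>"
proof -
  have "\<exists>N. \<forall>m\<ge>N. \<forall>n\<ge>N. (r m, p n) \<in> connected_avoiding \<Gamma> S"
    if S: "finite S" "S \<subseteq> verts \<Gamma>" for S
  proof -
    obtain N where N: "\<And>m n. m \<ge> N \<Longrightarrow> n \<ge> N \<Longrightarrow> (r m, q n) \<in> connected_avoiding \<Gamma> S"
      by (rule ray_equivD[OF rq S]) blast
    obtain M where M: "\<And>m n. m \<ge> M \<Longrightarrow> n \<ge> M \<Longrightarrow> (q m, p n) \<in> connected_avoiding \<Gamma> S"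
      by (rule ray_equivD[OF qp S]) blast
    have "(r m, p n) \<in> connected_avoiding \<Gamma> S" if "m \<ge> max N M" "n \<ge> max N M" for m n
      using connected_avoiding_trans[OF N[of m "max N M"] M[of "max N M" n]] that by simp
    then show ?thesis by blast
  qed
  then show ?thesis
    using ray_equiv_rays[OF rq] ray_equiv_rays[OF qp] by (intro ray_equivI) simp_all
qed

lemma equiv_ray_equiv: "equiv (rays \<Gamma>) (ray_equiv \<Gamma>)"
proof (rule equivI)
  show "ray_equiv \<Gamma> \<subseteq> rays \<Gamma> \<times> rays \<Gamma>"
    using ray_equiv_rays by auto
  show "refl_on (rays \<Gamma>) (ray_equiv \<Gamma>)"
    using ray_equiv_refl by (rule refl_onI)
  show "sym (ray_equiv \<Gamma>)"
    using ray_equiv_sym by (rule symI)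
  show "trans (ray_equiv \<Gamma>)"
    using ray_equiv_trans by (rule transI)
qed

text \<open>If no finite set told the ends apart, representatives would have tails in a common
  component for every finite set, which is the definition of equivalence.\<close>

lemma ends_separated:
  assumes "\<omega> \<in> graph_ends \<Gamma>" and "\<omega>' \<in> graph_ends \<Gamma>" and "\<omega> \<noteq> \<omega>'"
  shows "\<exists>S. finite S \<and> S \<subseteq> verts \<Gamma> \<and> end_component \<Gamma> S \<omega> \<noteq> end_component \<Gamma> S \<omega>'"
proof (rule ccontr)
  assume not: "\<not> ?thesis"
  have eq: "end_component \<Gamma> S \<omega> = end_component \<Gamma> S \<omega>'"
    if S: "finite S" "S \<subseteq> verts \<Gamma>" for S
    using not S by auto
  obtain r where r: "r \<in> rays \<Gamma>" "\<omega> = ray_equiv \<Gamma> `` {r}"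
    using assms(1) unfolding graph_ends_def by (rule quotientE)
  obtain q where q: "q \<in> rays \<Gamma>" "\<omega>' = ray_equiv \<Gamma> `` {q}"
    using assms(2) unfolding graph_ends_def by (rule quotientE)
  have "\<exists>N. \<forall>m\<ge>N. \<forall>n\<ge>N. (r m, q n) \<in> connected_avoiding \<Gamma> S"
    if S: "finite S" "S \<subseteq> verts \<Gamma>" for S
  proof -
    obtain N where N: "\<And>m n. m \<ge> N \<Longrightarrow> n \<ge> N \<Longrightarrow> (r m, r n) \<in> connected_avoiding \<Gamma> S"
      by (rule ray_equivD[OF ray_equiv_refl[OF r(1)] S]) blast
    have "r N \<in> end_component \<Gamma> S \<omega>"
      unfolding r(2) end_component_class[OF ray_equiv_refl[OF r(1)] S] using N by blast
    then have "r N \<in> end_component \<Gamma> S \<omega>'"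
      using eq[OF S] by simp
    then obtain M where M: "\<And>n. n \<ge> M \<Longrightarrow> (r N, q n) \<in> connected_avoiding \<Gamma> S"
      unfolding q(2) end_component_class[OF ray_equiv_refl[OF q(1)] S] by blast
    have "(r m, q n) \<in> connected_avoiding \<Gamma> S" if "m \<ge> max N M" "n \<ge> max N M" for m n
      using connected_avoiding_trans[OF N[of m N] M[of n]] that by simp
    then show ?thesis by blast
  qed
  then have "(r, q) \<in> ray_equiv \<Gamma>"
    using r(1) q(1) by (intro ray_equivI) simp_all
  then have "\<omega> = \<omega>'"
    unfolding r(2) q(2) by (rule equiv_class_eq[OF equiv_ray_equiv])
  with assms(3) show False by contradiction
qed

text \<open>A component is determined by any of its members: each side equals the set of vertices
  connected to \<open>x\<close>.\<close>

lemma end_components_disjoint: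
  assumes "\<omega> \<in> graph_ends \<Gamma>" and "\<omega>' \<in> graph_ends \<Gamma>" and "finite S" and "S \<subseteq> verts \<Gamma>"
    and "x \<in> end_component \<Gamma> S \<omega>" and "x \<in> end_component \<Gamma> S \<omega>'"
  shows "end_component \<Gamma> S \<omega> = end_component \<Gamma> S \<omega>'"
proof -
  have "end_component \<Gamma> S \<alpha> = {v. (x, v) \<in> connected_avoiding \<Gamma> S}"
    if \<alpha>: "\<alpha> \<in> graph_ends \<Gamma>" and x: "x \<in> end_component \<Gamma> S \<alpha>" for \<alpha>
  proof (intro equalityI subsetI)
    obtain r where r: "r \<in> rays \<Gamma>" "\<alpha> = ray_equiv \<Gamma> `` {r}"
      using \<alpha> unfolding graph_ends_def by (rule quotientE)
    note eq = end_component_class[OF ray_equiv_refl[OF r(1)] assms(3,4)]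
    fix v assume "v \<in> end_component \<Gamma> S \<alpha>"
    with x obtain N M where "\<forall>n\<ge>N. (x, r n) \<in> connected_avoiding \<Gamma> S"
      and "\<forall>n\<ge>M. (v, r n) \<in> connected_avoiding \<Gamma> S"
      unfolding r(2) eq by blast
    then have "(x, r (max N M)) \<in> connected_avoiding \<Gamma> S"
      and "(v, r (max N M)) \<in> connected_avoiding \<Gamma> S" by simp_all
    from connected_avoiding_trans[OF this(1) connected_avoiding_sym[OF this(2)]]
    show "v \<in> {v. (x, v) \<in> connected_avoiding \<Gamma> S}" by simp
  next
    fix v assume "v \<in> {v. (x, v) \<in> connected_avoiding \<Gamma> S}"
    then show "v \<in> end_component \<Gamma> S \<alpha>"
      using end_component_closed[OF x] by blast
  qed
  from this[OF assms(1,5)] this[OF assms(2,6)] show ?thesis by (simp only:)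
qed

lemma openin_freudenthal_complex:
  "complex_open \<Gamma> U \<Longrightarrow> openin (freudenthal \<Gamma>) (Complex_Point ` U)"
  unfolding freudenthal_def by (rule topology_generated_by_Basis) blast

lemma openin_freudenthal_end:
  assumes "finite S" and "S \<subseteq> verts \<Gamma>" and "\<omega> \<in> graph_ends \<Gamma>" and "0 < \<epsilon>"
  shows "openin (freudenthal \<Gamma>) (end_neighbourhood \<Gamma> S \<omega> \<epsilon>)"
  unfolding freudenthal_def by (rule topology_generated_by_Basis) (use assms in blast)

section \<open>Hausdorff property of the compactification\<close>

context simple_ugraph
begin

lemma complex_point_support:
  assumes "p \<in> complex_points \<Gamma>" and "p x > 0" and "p y > 0" and "x \<noteq> y"
  shows "{x, y} \<in> edges \<Gamma>"
  using assms(1)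
proof (cases rule: complex_pointE)
  case (vertex v)
  then show ?thesis
    using assms by (auto simp: vertex_point_apply split: if_splits)
next
  case (edge u v t)
  then show ?thesis
    using assms
    by (auto simp: edge_point_def vertex_point_apply insert_commute split: if_splits)
qed

text \<open>One of \<open>1 - t\<close> and \<open>t\<close> is at least 1/2. The fixed bound
  supplies a single vertex that keeps the point away from every end.\<close>

lemma complex_point_large_coordinate:
  assumes "p \<in> complex_points \<Gamma>"
  obtains x where "x \<in> verts \<Gamma>" and "p x \<ge> 1 / 2"
  using assms
proof (cases rule: complex_pointE)
  case (vertex v)
  then show ?thesis
    using that[of v] by (simp add: vertex_point_apply)
next
  case (edge u v t)
  then have "p u = 1 - t" "p v = t"
    using edgeD[OF edge(1)] by (auto simp: edge_point_def vertex_point_apply)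
  then show ?thesis
    using that[of u] that[of v] edgeD[OF edge(1)] by (cases "t \<le> 1 / 2") auto
qed

lemma complex_points_separated:
  assumes "p \<in> complex_points \<Gamma>" and "q \<in> complex_points \<Gamma>" and "p \<noteq> q"
  shows "\<exists>U V. complex_open \<Gamma> U \<and> complex_open \<Gamma> V \<and> p \<in> U \<and> q \<in> V \<and> U \<inter> V = {}"
proof -
  have less: "\<exists>U V. complex_open \<Gamma> U \<and> complex_open \<Gamma> V \<and> p \<in> U \<and> q \<in> V \<and> U \<inter> V = {}"
    if pq: "p \<in> complex_points \<Gamma>" "q \<in> complex_points \<Gamma>" "p x < q x" for p q x
  proof -
    obtain c where c: "p x < c" "c < q x" using pq(3) dense by blast
    have "{r \<in> complex_points \<Gamma>. r x \<in> {..<c}} \<inter> {r \<in> complex_points \<Gamma>. r x \<in> {c<..}} = {}"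
      and "p \<in> {r \<in> complex_points \<Gamma>. r x \<in> {..<c}}"
      and "q \<in> {r \<in> complex_points \<Gamma>. r x \<in> {c<..}}"
      using c pq by auto
    then show ?thesis
      using complex_open_coordinate[OF open_lessThan, of \<Gamma> x c]
        complex_open_coordinate[OF open_greaterThan, of \<Gamma> x c] by blast
  qed
  obtain x where "p x \<noteq> q x" using assms(3) by blast
  then consider "p x < q x" | "q x < p x" by linarith
  then show ?thesis
  proof cases
    case 1
    with assms(1,2) show ?thesis by (rule less)
  next
    case 2
    from less[OF assms(2,1) this] show ?thesis by blast
  qed
qed

lemma complex_point_end_separated:
  assumes p: "p \<in> complex_points \<Gamma>" and \<omega>: "\<omega> \<in> graph_ends \<Gamma>"
  shows "\<exists>U V. openin (freudenthal \<Gamma>) U \<and> openin (freudenthal \<Gamma>) V \<and>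
    Complex_Point p \<in> U \<and> End_Point \<omega> \<in> V \<and> U \<inter> V = {}"
proof -
  obtain x where x: "x \<in> verts \<Gamma>" "p x \<ge> 1 / 2"
    using p by (rule complex_point_large_coordinate)
  \<comment> \<open>The threshold 1/4 lies below 1/2: the weight at \<open>x\<close> exceeds it on
    \<open>U\<close> and stays below it on the end neighbourhood for the set
    \<open>{x}\<close>.\<close>
  define U where "U = {q \<in> complex_points \<Gamma>. q x \<in> {1 / 4<..}}"
  have "complex_open \<Gamma> U"
    unfolding U_def by (rule complex_open_coordinate) simp
  then have "openin (freudenthal \<Gamma>) (Complex_Point ` U)"
    by (rule openin_freudenthal_complex)
  moreover have "openin (freudenthal \<Gamma>) (end_neighbourhood \<Gamma> {x} \<omega> (1 / 4))"
    using x(1) \<omega> by (intro openin_freudenthal_end) auto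
  moreover have "Complex_Point p \<in> Complex_Point ` U"
    using p x unfolding U_def by auto
  moreover have "End_Point \<omega> \<in> end_neighbourhood \<Gamma> {x} \<omega> (1 / 4)"
    using \<omega> by (simp add: end_neighbourhood_eq)
  moreover have "Complex_Point ` U \<inter> end_neighbourhood \<Gamma> {x} \<omega> (1 / 4) = {}"
    by (auto simp: end_neighbourhood_eq U_def component_points_def)
  ultimately show ?thesis by blast
qed

text \<open>A point with weight in both components would lie on an edge joining them. Components are
  closed under edges outside \<open>S\<close>, so they would share a vertex and coincide.\<close>

lemma end_points_separated:
  assumes "\<omega> \<in> graph_ends \<Gamma>" and "\<omega>' \<in> graph_ends \<Gamma>" and "\<omega> \<noteq> \<omega>'"
  shows "\<exists>U V. openin (freudenthal \<Gamma>) U \<and> openin (freudenthal \<Gamma>) V \<and>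
    End_Point \<omega> \<in> U \<and> End_Point \<omega>' \<in> V \<and> U \<inter> V = {}"
proof -
  obtain S where S: "finite S" "S \<subseteq> verts \<Gamma>"
    and ne: "end_component \<Gamma> S \<omega> \<noteq> end_component \<Gamma> S \<omega>'"
    using ends_separated[OF assms] by auto
  have disj: False if "x \<in> end_component \<Gamma> S \<omega>" "x \<in> end_component \<Gamma> S \<omega>'" for x
    using end_components_disjoint[OF assms(1,2) S that] ne by contradiction
  have "component_points \<Gamma> S (end_component \<Gamma> S \<omega>) 1 \<inter>
    component_points \<Gamma> S (end_component \<Gamma> S \<omega>') 1 = {}"
  proof (rule equals0I)
    fix p assume "p \<in> component_points \<Gamma> S (end_component \<Gamma> S \<omega>) 1 \<inter>
      component_points \<Gamma> S (end_component \<Gamma> S \<omega>') 1"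
    then obtain x y where p: "p \<in> complex_points \<Gamma>" "p x > 0" "p y > 0"
      and x: "x \<in> end_component \<Gamma> S \<omega>" and y: "y \<in> end_component \<Gamma> S \<omega>'"
      unfolding component_points_def by blast
    have "{x, y} \<in> edges \<Gamma>"
      using p by (rule complex_point_support) (use disj x y in blast)
    from end_component_edge[OF x this subsetD[OF end_component_subset y]] y
    show False by (rule disj)
  qed
  then have "end_neighbourhood \<Gamma> S \<omega> 1 \<inter> end_neighbourhood \<Gamma> S \<omega>' 1 = {}"
    using ne by (auto simp: end_neighbourhood_eq)
  moreover have "openin (freudenthal \<Gamma>) (end_neighbourhood \<Gamma> S \<omega> 1)"
    and "openin (freudenthal \<Gamma>) (end_neighbourhood \<Gamma> S \<omega>' 1)"
    using S assms by (simp_all add: openin_freudenthal_end)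
  moreover have "End_Point \<omega> \<in> end_neighbourhood \<Gamma> S \<omega> 1"
    and "End_Point \<omega>' \<in> end_neighbourhood \<Gamma> S \<omega>' 1"
    using assms by (simp_all add: end_neighbourhood_eq)
  ultimately show ?thesis by blast
qed

lemma Hausdorff_freudenthal: "Hausdorff_space (freudenthal \<Gamma>)"
  unfolding Hausdorff_space_def disjnt_def topspace_freudenthal
proof (intro allI impI, elim conjE)
  fix P Q :: "'v freudenthal_point"
  assume P: "P \<in> Complex_Point ` complex_points \<Gamma> \<union> End_Point ` graph_ends \<Gamma>"
    and Q: "Q \<in> Complex_Point ` complex_points \<Gamma> \<union> End_Point ` graph_ends \<Gamma>"
    and ne: "P \<noteq> Q"
  show "\<exists>U V. openin (freudenthal \<Gamma>) U \<and> openin (freudenthal \<Gamma>) V \<and> P \<in> U \<and> Q \<in> V \<and> U \<inter> V = {}"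
  proof (cases P; cases Q)
    fix p q assume PQ: "P = Complex_Point p" "Q = Complex_Point q"
    then have "p \<in> complex_points \<Gamma>" "q \<in> complex_points \<Gamma>" "p \<noteq> q"
      using P Q ne by auto
    from complex_points_separated[OF this] obtain U V
      where UV: "complex_open \<Gamma> U" "complex_open \<Gamma> V" "p \<in> U" "q \<in> V" "U \<inter> V = {}" by blast
    have "Complex_Point ` U \<inter> Complex_Point ` V = {}"
      using UV(5) by auto
    then show ?thesis
      using openin_freudenthal_complex[OF UV(1)] openin_freudenthal_complex[OF UV(2)] UV(3,4) PQ
      by blast
  next
    fix p \<omega> assume PQ: "P = Complex_Point p" "Q = End_Point \<omega>"
    then have "p \<in> complex_points \<Gamma>" "\<omega> \<in> graph_ends \<Gamma>"
      using P Q by auto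
    from complex_point_end_separated[OF this] show ?thesis
      unfolding PQ .
  next
    fix p \<omega> assume PQ: "P = End_Point \<omega>" "Q = Complex_Point p"
    then have "p \<in> complex_points \<Gamma>" "\<omega> \<in> graph_ends \<Gamma>"
      using P Q by auto
    from complex_point_end_separated[OF this] show ?thesis
      unfolding PQ by blast
  next
    fix \<omega> \<omega>' assume PQ: "P = End_Point \<omega>" "Q = End_Point \<omega>'"
    then have "\<omega> \<in> graph_ends \<Gamma>" "\<omega>' \<in> graph_ends \<Gamma>" "\<omega> \<noteq> \<omega>'"
      using P Q ne by auto
    from end_points_separated[OF this] show ?thesis
      unfolding PQ .
  qed
qed

end

section \<open>Circles from two double rays\<close>

definition double_rays :: "'v ugraph \<Rightarrow> (int \<Rightarrow> 'v) set" where
  "double_rays \<Gamma> = {a. inj a \<and> range a \<subseteq> verts \<Gamma> \<and> (\<forall>k. {a k, a (k + 1)} \<in> edges \<Gamma>)}"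

text \<open>The real line mapped along a double ray: the coordinate of the vertex \<^term>\<open>a k\<close> is the tent
  function centred at \<^term>\<open>k\<close>.\<close>
definition path_point :: "(int \<Rightarrow> 'v) \<Rightarrow> real \<Rightarrow> 'v \<Rightarrow> real" where
  "path_point a s = (\<lambda>x. if x \<in> range a then max 0 (1 - \<bar>s - of_int (the_inv a x)\<bar>) else 0)"

lemma path_point_at:
  "inj a \<Longrightarrow> path_point a s (a k) = max 0 (1 - \<bar>s - of_int k\<bar>)"
  by (simp add: path_point_def the_inv_f_f)

lemma path_point_outside: "x \<notin> range a \<Longrightarrow> path_point a s x = 0"
  by (simp add: path_point_def the_inv_f_f)

text \<open>Links the tent functions, which make injectivity visible, to the edge parametrisation,
  through which the topology is defined. Between \<open>k\<close> and \<open>k + 1\<close> all other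
  tents vanish.\<close>

lemma path_point_eq_edge_point:
  assumes "inj a" and "of_int k \<le> s" and "s \<le> of_int k + 1"
  shows "path_point a s = edge_point (a k) (a (k + 1)) (s - of_int k)"
proof
  fix x
  show "path_point a s x = edge_point (a k) (a (k + 1)) (s - of_int k) x"
  proof (cases "x \<in> range a")
    case True
    then obtain m where x: "x = a m" by blast
    consider "m = k" | "m = k + 1" | "m \<le> k - 1" | "m \<ge> k + 2" by linarith
    then show ?thesis
    proof cases
      case 3
      then have "real_of_int m \<le> of_int k - 1" by linarith
      then show ?thesis
        using 3 assms by (simp add: x path_point_at edge_point_def vertex_point_apply inj_eq)
    next
      case 4
      then have "real_of_int m \<ge> of_int k + 2" by linarith
      then show ?thesis
        using 4 assms by (simp add: x path_point_at edge_point_def vertex_point_apply inj_eq)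
    qed (use assms in \<open>auto simp: x path_point_at edge_point_def vertex_point_apply inj_eq\<close>)
  next
    case False
    then show ?thesis
      by (auto simp: path_point_outside edge_point_def vertex_point_apply)
  qed
qed

lemma path_point_of_int: "inj a \<Longrightarrow> path_point a (of_int k) = vertex_point (a k)"
  by (subst path_point_eq_edge_point[of a k]) simp_all

text \<open>One tent determines \<open>s\<close> only up to reflection in its centre; the tents at
  \<open>\<lfloor>s\<rfloor>\<close> and at its successor together determine it.\<close>

lemma path_point_inject:
  assumes "inj a" and "path_point a s = path_point a s'"
  shows "s = s'"
proof -
  define k where "k = \<lfloor>s\<rfloor>"
  have k: "of_int k \<le> s" "s < of_int k + 1"
    unfolding k_def by linarith+
  have "max 0 (1 - \<bar>s - of_int k\<bar>) = max 0 (1 - \<bar>s' - of_int k\<bar>)"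
    using assms by (metis path_point_at)
  moreover have "max 0 (1 - \<bar>s - of_int (k + 1)\<bar>) = max 0 (1 - \<bar>s' - of_int (k + 1)\<bar>)"
    using assms by (metis path_point_at)
  ultimately show ?thesis
    using k by (simp add: max_def abs_if split: if_splits)
qed

lemma path_point_floor_pos: "inj a \<Longrightarrow> path_point a s (a \<lfloor>s\<rfloor>) > 0"
  unfolding path_point_at by linarith

lemma path_point_disjoint:
  assumes "inj a" and "range a \<inter> range b = {}"
  shows "path_point a s \<noteq> path_point b s'"
proof
  assume eq: "path_point a s = path_point b s'"
  have "a \<lfloor>s\<rfloor> \<notin> range b" using assms(2) by blast
  from path_point_outside[OF this, of s'] path_point_floor_pos[OF assms(1), of s]
  show False by (simp add: eq)
qed

lemma path_point_in_complex:
  assumes "a \<in> double_rays \<Gamma>"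
  shows "path_point a s \<in> complex_points \<Gamma>"
proof -
  have s: "of_int \<lfloor>s\<rfloor> \<le> s" "s \<le> of_int \<lfloor>s\<rfloor> + 1" by linarith+
  have inj: "inj a" and e: "{a \<lfloor>s\<rfloor>, a (\<lfloor>s\<rfloor> + 1)} \<in> edges \<Gamma>"
    using assms unfolding double_rays_def by auto
  show ?thesis
    unfolding path_point_eq_edge_point[OF inj s]
    by (rule edge_point_in_complex[OF e]) (use s in linarith)+
qed

text \<open>Openness in the complex is tested on each edge separately, while a neighbourhood of an
  integer parameter reaches into two edges.\<close>

lemma open_path_point_vimage:
  assumes a: "a \<in> double_rays \<Gamma>" and U: "complex_open \<Gamma> U"
  shows "open {s. path_point a s \<in> U}"
  unfolding open_dist
proof (intro ballI)
  fix s assume "s \<in> {s. path_point a s \<in> U}"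
  then have s: "path_point a s \<in> U" by simp
  have inj: "inj a" and e: "\<And>k. {a k, a (k + 1)} \<in> edges \<Gamma>"
    using a unfolding double_rays_def by auto
  have local: "\<exists>d>0. \<forall>t. of_int k \<le> t \<and> t \<le> of_int k + 1 \<and> \<bar>t - s\<bar> < d \<longrightarrow> path_point a t \<in> U"
    if k: "of_int k \<le> s" "s \<le> of_int k + 1" for k
  proof -
    let ?T = "{t \<in> {0..1}. edge_point (a k) (a (k + 1)) t \<in> U}"
    have "openin (top_of_set {0..1}) ?T"
      using U e unfolding complex_open_def by blast
    moreover have "s - of_int k \<in> ?T"
      using s k path_point_eq_edge_point[OF inj k] by simp
    ultimately obtain d where d: "d > 0"
      and sub: "\<And>t. t \<in> {0..1} \<Longrightarrow> dist t (s - of_int k) < d \<Longrightarrow> t \<in> ?T"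
      unfolding openin_euclidean_subtopology_iff by (metis (no_types, lifting))
    have "path_point a t \<in> U" if t: "of_int k \<le> t" "t \<le> of_int k + 1" "\<bar>t - s\<bar> < d" for t
      using sub[of "t - of_int k"] t path_point_eq_edge_point[OF inj t(1,2)]
      by (simp add: dist_real_def)
    with d show ?thesis by blast
  qed
  \<comment> \<open>The edge to the right of \<open>s\<close> has index
    \<open>\<lfloor>s\<rfloor>\<close>, the edge to the left \<open>\<lceil>s\<rceil> - 1\<close>;
    they coincide unless \<open>s\<close> is an integer.\<close>
  obtain d1 where d1: "d1 > 0"
    and p1: "\<And>t. of_int \<lfloor>s\<rfloor> \<le> t \<Longrightarrow> t \<le> of_int \<lfloor>s\<rfloor> + 1 \<Longrightarrow> \<bar>t - s\<bar> < d1 \<Longrightarrow> path_point a t \<in> U"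
    using local[of "\<lfloor>s\<rfloor>"] by (auto; linarith?)
  obtain d2 where d2: "d2 > 0"
    and p2: "\<And>t. of_int (\<lceil>s\<rceil> - 1) \<le> t \<Longrightarrow> t \<le> of_int (\<lceil>s\<rceil> - 1) + 1 \<Longrightarrow> \<bar>t - s\<bar> < d2 \<Longrightarrow>
      path_point a t \<in> U"
    using local[of "\<lceil>s\<rceil> - 1"] by (auto; linarith?)
  \<comment> \<open>The last two bounds keep \<open>t\<close> inside the unit intervals of these two
    edges.\<close>
  define d where "d = Min {d1, d2, of_int \<lfloor>s\<rfloor> + 1 - s, s - of_int \<lceil>s\<rceil> + 1}"
  have "d > 0"
    unfolding d_def using d1 d2 by (simp; linarith)
  moreover have "path_point a t \<in> U" if "dist t s < d" for t
  proof -
    have t: "\<bar>t - s\<bar> < d1" "\<bar>t - s\<bar> < d2" "\<bar>t - s\<bar> < of_int \<lfloor>s\<rfloor> + 1 - s"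
      "\<bar>t - s\<bar> < s - of_int \<lceil>s\<rceil> + 1"
      using that unfolding d_def dist_real_def by simp_all
    show ?thesis
    proof (cases "t \<ge> s")
      case True
      then show ?thesis using t by (intro p1) linarith+
    next
      case False
      then show ?thesis using t by (intro p2) (simp_all; linarith)+
    qed
  qed
  ultimately show "\<exists>d>0. \<forall>t. dist t s < d \<longrightarrow> t \<in> {s. path_point a s \<in> U}" by blast
qed

lemma path_point_in_component_points:
  assumes a: "a \<in> double_rays \<Gamma>" and "a \<lfloor>s\<rfloor> \<in> C" and "a (\<lfloor>s\<rfloor> + 1) \<in> C" and "C \<inter> S = {}" and "0 < \<epsilon>"
  shows "path_point a s \<in> component_points \<Gamma> S C \<epsilon>"
proof -
  have inj: "inj a" using a unfolding double_rays_def by auto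
  have eq: "path_point a s = edge_point (a \<lfloor>s\<rfloor>) (a (\<lfloor>s\<rfloor> + 1)) (s - of_int \<lfloor>s\<rfloor>)"
    by (intro path_point_eq_edge_point inj) linarith+
  have "path_point a s v = 0" if "v \<in> S" for v
  proof -
    have "v \<noteq> a \<lfloor>s\<rfloor>" "v \<noteq> a (\<lfloor>s\<rfloor> + 1)" using assms that by auto
    then show ?thesis by (simp add: eq edge_point_def vertex_point_apply)
  qed
  then show ?thesis
    using path_point_in_complex[OF a] path_point_floor_pos[OF inj, of s] assms(2,5)
    unfolding component_points_def by auto
qed

text \<open>The open upper and lower half circle are sent along the two double rays, and \<^term>\<open>1\<close> and
  \<^term>\<open>-1\<close> to the two ends.\<close>
definition circle_map ::
    "(int \<Rightarrow> 'v) \<Rightarrow> (int \<Rightarrow> 'v) \<Rightarrow> (nat \<Rightarrow> 'v) set \<Rightarrow> (nat \<Rightarrow> 'v) set \<Rightarrow> complex \<Rightarrow> 'v freudenthal_point"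
  where
  "circle_map a b \<omega> \<omega>' z =
    (if Im z > 0 then Complex_Point (path_point a (Re z / Im z))
     else if Im z < 0 then Complex_Point (path_point b (- (Re z / Im z)))
     else if Re z > 0 then End_Point \<omega> else End_Point \<omega>')"

text \<open>With slope \<open>s\<close> the circle equation becomes
  \<open>(s\<^sup>2 + 1) * (Im z)\<^sup>2 = 1\<close>. This gives \<open>Im z\<close> up to sign,
  and the sign is shared.\<close>

lemma sphere_slope_inject:
  assumes "z \<in> sphere (0::complex) 1" and "w \<in> sphere 0 1" and "Im z * Im w > 0"
    and "Re z / Im z = Re w / Im w"
  shows "z = w"
proof -
  have z: "(Re z)\<^sup>2 + (Im z)\<^sup>2 = 1" and w: "(Re w)\<^sup>2 + (Im w)\<^sup>2 = 1"
    using assms(1,2) cmod_power2[of z] cmod_power2[of w] by simp_all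
  have ne: "Im z \<noteq> 0" "Im w \<noteq> 0" using assms(3) by auto
  define s where "s = Re z / Im z"
  have rz: "Re z = s * Im z"
    using ne by (simp add: s_def)
  have rw: "Re w = s * Im w"
    using ne by (simp add: s_def assms(4))
  have "(s\<^sup>2 + 1) * (Im z)\<^sup>2 = 1" "(s\<^sup>2 + 1) * (Im w)\<^sup>2 = 1"
    using z w unfolding rz rw by (simp_all add: power_mult_distrib algebra_simps)
  moreover have "s\<^sup>2 + 1 \<noteq> 0"
    by (metis add_nonneg_pos less_irrefl zero_le_power2 zero_less_one)
  ultimately have "(Im z)\<^sup>2 = (Im w)\<^sup>2"
    by (metis mult_cancel_left)
  then have "Im z = Im w"
    using assms(3) by (auto simp: power2_eq_iff mult_less_0_iff zero_less_mult_iff)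
  then show ?thesis
    using rz rw by (simp add: complex_eq_iff)
qed

lemma sphere_Im_0:
  assumes "z \<in> sphere (0::complex) 1" and "Im z = 0"
  shows "z = 1 \<or> z = -1"
proof -
  have "(Re z)\<^sup>2 = 1" using assms cmod_power2[of z] by simp
  then show ?thesis
    using assms(2) by (auto simp: complex_eq_iff power2_eq_1_iff)
qed

lemma inj_on_circle_map:
  assumes "inj a" and "inj b" and "range a \<inter> range b = {}" and "\<omega> \<noteq> \<omega>'"
  shows "inj_on (circle_map a b \<omega> \<omega>') (sphere 0 1)"
proof (rule inj_onI)
  fix z w :: complex
  assume z: "z \<in> sphere 0 1" and w: "w \<in> sphere 0 1"
    and eq: "circle_map a b \<omega> \<omega>' z = circle_map a b \<omega> \<omega>' w"
  have ba: "path_point b s \<noteq> path_point a s'" for s s'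
    using path_point_disjoint[OF assms(1,3)] by metis
  consider "Im z > 0" "Im w > 0" | "Im z < 0" "Im w < 0" | "Im z = 0" "Im w = 0"
    using eq path_point_disjoint[OF assms(1,3)] ba
    by (auto simp: circle_map_def split: if_splits)
  then show "z = w"
  proof cases
    case 1
    with eq have "Re z / Im z = Re w / Im w"
      by (auto simp: circle_map_def dest: path_point_inject[OF assms(1)])
    with z w 1 show ?thesis by (intro sphere_slope_inject) auto
  next
    case 2
    with eq have "Re z / Im z = Re w / Im w"
      by (auto simp: circle_map_def dest: path_point_inject[OF assms(2)])
    with z w 2 show ?thesis by (intro sphere_slope_inject) (auto simp: mult_neg_neg)
  next
    case 3
    with sphere_Im_0[OF z] sphere_Im_0[OF w] eq assms(4) show ?thesis
      by (auto simp: circle_map_def)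
  qed
qed

text \<open>Points with \<open>Im z = 0\<close> go to ends, so only the two open half planes
  contribute. As \<open>circle_map\<close> is defined on the whole plane, the preimage is open there
  and not merely in the circle.\<close>

lemma open_circle_map_vimage_complex:
  assumes "a \<in> double_rays \<Gamma>" and "b \<in> double_rays \<Gamma>" and "complex_open \<Gamma> U"
  shows "open (circle_map a b \<omega> \<omega>' -` Complex_Point ` U)"
proof -
  have cont: "continuous_on {z. Im z > 0} (\<lambda>z. Re z / Im z)"
    "continuous_on {z. Im z < 0} (\<lambda>z. - (Re z / Im z))"
    by (intro continuous_intros; auto)+
  have "open ((\<lambda>z. Re z / Im z) -` {s. path_point a s \<in> U} \<inter> {z. Im z > 0})"
    by (rule continuous_on_open_vimage[OF open_halfspace_Im_gt, THEN iffD1, OF cont(1), rule_format])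
      (rule open_path_point_vimage[OF assms(1,3)])
  moreover have "open ((\<lambda>z. - (Re z / Im z)) -` {s. path_point b s \<in> U} \<inter> {z. Im z < 0})"
    by (rule continuous_on_open_vimage[OF open_halfspace_Im_lt, THEN iffD1, OF cont(2), rule_format])
      (rule open_path_point_vimage[OF assms(2,3)])
  moreover have "circle_map a b \<omega> \<omega>' -` Complex_Point ` U =
    (\<lambda>z. Re z / Im z) -` {s. path_point a s \<in> U} \<inter> {z. Im z > 0} \<union>
    (\<lambda>z. - (Re z / Im z)) -` {s. path_point b s \<in> U} \<inter> {z. Im z < 0}"
    by (auto simp: circle_map_def split: if_splits)
  ultimately show ?thesis by (simp only: open_Un)
qed

text \<open>Near \<^term>\<open>1\<close> the slope \<^term>\<open>Re z / \<bar>Im z\<bar>\<close> exceeds any bound, so that tails of both double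
  rays account for a whole neighbourhood.\<close>
lemma circle_map_near_1:
  assumes "\<And>s. s > M \<Longrightarrow> Complex_Point (path_point a s) \<in> W"
    and "\<And>s. s > M \<Longrightarrow> Complex_Point (path_point b s) \<in> W" and "End_Point \<omega> \<in> W"
  shows "\<exists>T. open T \<and> 1 \<in> T \<and> T \<subseteq> circle_map a b \<omega> \<omega>' -` W"
proof (intro exI conjI)
  let ?T = "{z. M * \<bar>Im z\<bar> < Re z} \<inter> {z. Re z > 0}"
  show "open ?T"
    by (intro open_Int open_Collect_less continuous_intros)
  show "1 \<in> ?T" by simp
  show "?T \<subseteq> circle_map a b \<omega> \<omega>' -` W"
  proof
    fix z assume z: "z \<in> ?T"
    then have "M < Re z / Im z" if "Im z > 0"
      using that by (simp add: pos_less_divide_eq)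
    moreover have "M < - (Re z / Im z)" if "Im z < 0"
      using that z pos_less_divide_eq[of "- Im z" M "Re z"] by simp
    ultimately show "z \<in> circle_map a b \<omega> \<omega>' -` W"
      using assms z by (simp add: circle_map_def)
  qed
qed

lemma circle_map_near_minus_1:
  assumes "\<And>s. s < M \<Longrightarrow> Complex_Point (path_point a s) \<in> W"
    and "\<And>s. s < M \<Longrightarrow> Complex_Point (path_point b s) \<in> W" and "End_Point \<omega>' \<in> W"
  shows "\<exists>T. open T \<and> -1 \<in> T \<and> T \<subseteq> circle_map a b \<omega> \<omega>' -` W"
proof (intro exI conjI)
  let ?T = "{z. Re z < M * \<bar>Im z\<bar>} \<inter> {z. Re z < 0}"
  show "open ?T"
    by (intro open_Int open_Collect_less continuous_intros)
  show "-1 \<in> ?T" by simp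
  show "?T \<subseteq> circle_map a b \<omega> \<omega>' -` W"
  proof
    fix z assume z: "z \<in> ?T"
    then have "Re z / Im z < M" if "Im z > 0"
      using that by (simp add: pos_divide_less_eq)
    moreover have "- (Re z / Im z) < M" if "Im z < 0"
      using that z pos_divide_less_eq[of "- Im z" "Re z" M] by simp
    ultimately show "z \<in> circle_map a b \<omega> \<omega>' -` W"
      using assms z by (simp add: circle_map_def)
  qed
qed

context simple_ugraph
begin

text \<open>Continuity is checked on the generating open sets. Away from 1 and -1 only the complex
  part of an end neighbourhood matters, and it is open in the complex; at 1 and -1 the tails of both
  rays lie in the component concerned.\<close>

lemma continuous_circle_map:
  assumes a: "a \<in> double_rays \<Gamma>" and b: "b \<in> double_rays \<Gamma>"
    and \<omega>: "\<omega> \<in> graph_ends \<Gamma>" and \<omega>': "\<omega>' \<in> graph_ends \<Gamma>"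
    and plus: "\<And>S. finite S \<Longrightarrow> S \<subseteq> verts \<Gamma> \<Longrightarrow>
      \<exists>N. \<forall>k\<ge>N. a k \<in> end_component \<Gamma> S \<omega> \<and> b k \<in> end_component \<Gamma> S \<omega>"
    and minus: "\<And>S. finite S \<Longrightarrow> S \<subseteq> verts \<Gamma> \<Longrightarrow>
      \<exists>N. \<forall>k\<le>N. a k \<in> end_component \<Gamma> S \<omega>' \<and> b k \<in> end_component \<Gamma> S \<omega>'"
  shows "continuous_map (top_of_set (sphere 0 1)) (freudenthal \<Gamma>) (circle_map a b \<omega> \<omega>')"
  unfolding freudenthal_def
proof (rule continuous_on_generated_topo)
  let ?f = "circle_map a b \<omega> \<omega>'"
  let ?B = "{Complex_Point ` U | U. complex_open \<Gamma> U} \<union>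
    {end_neighbourhood \<Gamma> S \<omega> \<epsilon> | S \<omega> \<epsilon>. finite S \<and> S \<subseteq> verts \<Gamma> \<and> \<omega> \<in> graph_ends \<Gamma> \<and> 0 < \<epsilon>}"
  have "\<Union>?B = topspace (freudenthal \<Gamma>)"
    unfolding freudenthal_def topology_generated_by_topspace ..
  then show "?f ` topspace (top_of_set (sphere 0 1)) \<subseteq> \<Union>?B"
    using path_point_in_complex[OF a] path_point_in_complex[OF b] \<omega> \<omega>'
    unfolding topspace_freudenthal by (auto simp: circle_map_def)
  fix W assume "W \<in> ?B"
  then consider (complex) U where "complex_open \<Gamma> U" "W = Complex_Point ` U"
    | (infinity) S \<alpha> \<epsilon> where "finite S" "S \<subseteq> verts \<Gamma>" "\<alpha> \<in> graph_ends \<Gamma>" "0 < \<epsilon>"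
        "W = end_neighbourhood \<Gamma> S \<alpha> \<epsilon>"
    by auto
  then show "openin (top_of_set (sphere 0 1)) (?f -` W \<inter> topspace (top_of_set (sphere 0 1)))"
  proof cases
    case complex
    then show ?thesis
      using openin_open_Int[OF open_circle_map_vimage_complex[OF a b complex(1), of \<omega> \<omega>']]
      by (simp add: Int_commute)
  next
    case infinity
    define C where "C = end_component \<Gamma> S \<alpha>"
    have CS: "C \<inter> S = {}"
      using end_component_subset[of \<Gamma> S \<alpha>] unfolding C_def by auto
    have W: "W = Complex_Point ` component_points \<Gamma> S C \<epsilon> \<union>
      End_Point ` {\<omega>'' \<in> graph_ends \<Gamma>. end_component \<Gamma> S \<omega>'' = C}"
      unfolding infinity C_def by (rule end_neighbourhood_eq[OF infinity(4)])
    let ?V = "?f -` Complex_Point ` component_points \<Gamma> S C \<epsilon>"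
    have V: "open ?V"
      by (rule open_circle_map_vimage_complex[OF a b complex_open_component_points[OF infinity(1)]])
    have in1: "\<exists>T. open T \<and> 1 \<in> T \<and> T \<subseteq> ?f -` W" if "End_Point \<omega> \<in> W"
    proof -
      \<comment> \<open>\<open>W\<close> may have been chosen around another end
        \<open>\<alpha>\<close>; as it contains \<open>\<omega>\<close>, its component is that of
        \<open>\<omega>\<close>.\<close>
      have C: "C = end_component \<Gamma> S \<omega>" using that unfolding W by auto
      obtain N where N: "\<And>k. k \<ge> N \<Longrightarrow> a k \<in> C \<and> b k \<in> C"
        using plus[OF infinity(1,2)] unfolding C by auto
      have fl: "\<lfloor>s\<rfloor> \<ge> N" if "s > of_int N" for s :: real
        using that by linarith
      show ?thesis
      proof (rule circle_map_near_1[of "of_int N"])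
        fix s :: real assume "s > of_int N"
        from fl[OF this] N[of "\<lfloor>s\<rfloor>"] N[of "\<lfloor>s\<rfloor> + 1"]
        have "path_point a s \<in> component_points \<Gamma> S C \<epsilon>" "path_point b s \<in> component_points \<Gamma> S C \<epsilon>"
          using CS infinity(4) by (simp_all add: path_point_in_component_points[OF a]
              path_point_in_component_points[OF b])
        then show "Complex_Point (path_point a s) \<in> W" "Complex_Point (path_point b s) \<in> W"
          unfolding W by blast+
      qed (rule that)
    qed
    have in2: "\<exists>T. open T \<and> -1 \<in> T \<and> T \<subseteq> ?f -` W" if "End_Point \<omega>' \<in> W"
    proof -
      have C: "C = end_component \<Gamma> S \<omega>'" using that unfolding W by auto
      obtain N where N: "\<And>k. k \<le> N \<Longrightarrow> a k \<in> C \<and> b k \<in> C"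
        using minus[OF infinity(1,2)] unfolding C by auto
      \<comment> \<open>Both endpoints of the edge must be at most \<open>N\<close>. Strictness of
        \<open>s < of_int N\<close> provides the extra 1, since \<open>N\<close> is an
        integer.\<close>
      have fl: "\<lfloor>s\<rfloor> + 1 \<le> N" if "s < of_int N" for s :: real
        using that by linarith
      show ?thesis
      proof (rule circle_map_near_minus_1[of "of_int N"])
        fix s :: real assume "s < of_int N"
        from fl[OF this] N[of "\<lfloor>s\<rfloor>"] N[of "\<lfloor>s\<rfloor> + 1"]
        have "path_point a s \<in> component_points \<Gamma> S C \<epsilon>" "path_point b s \<in> component_points \<Gamma> S C \<epsilon>"
          using CS infinity(4) by (simp_all add: path_point_in_component_points[OF a]
              path_point_in_component_points[OF b])
        then show "Complex_Point (path_point a s) \<in> W" "Complex_Point (path_point b s) \<in> W"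
          unfolding W by blast+
      qed (rule that)
    qed
    have nbhd: "\<exists>T. open T \<and> z \<in> T \<and> T \<subseteq> ?f -` W" if z: "z \<in> sphere 0 1" "?f z \<in> W" for z
    proof (cases "Im z = 0")
      case True
      from sphere_Im_0[OF z(1) True] z(2) in1 in2 show ?thesis
        by (auto simp: circle_map_def)
    next
      case False
      with z(2) have "z \<in> ?V"
        unfolding W by (auto simp: circle_map_def split: if_splits)
      moreover have "?V \<subseteq> ?f -` W" unfolding W by blast
      ultimately show ?thesis using V by blast
    qed
    have "?f -` W \<inter> sphere 0 1 = sphere 0 1 \<inter> \<Union>{T. open T \<and> T \<subseteq> ?f -` W}"
    proof (intro equalityI subsetI)
      fix z assume z: "z \<in> ?f -` W \<inter> sphere 0 1"
      with nbhd[of z] obtain T where "open T" "z \<in> T" "T \<subseteq> ?f -` W" by auto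
      with z show "z \<in> sphere 0 1 \<inter> \<Union>{T. open T \<and> T \<subseteq> ?f -` W}" by blast
    qed blast
    moreover have "openin (top_of_set (sphere 0 1)) (sphere 0 1 \<inter> \<Union>{T. open T \<and> T \<subseteq> ?f -` W})"
      by (rule openin_open_Int) auto
    ultimately show ?thesis by (simp only: topspace_euclidean_subtopology)
  qed
qed

text \<open>\<open>plus\<close> and \<open>minus\<close> make the rays converge to common ends on
  either side, and \<open>sep\<close> makes these ends different; if they were equal, the map would
  identify 1 and -1.\<close>

theorem hamilton_circle_of_double_rays:
  assumes a: "a \<in> double_rays \<Gamma>" and b: "b \<in> double_rays \<Gamma>"
    and disj: "range a \<inter> range b = {}" and cover: "verts \<Gamma> = range a \<union> range b"
    and plus: "\<And>S. finite S \<Longrightarrow> S \<subseteq> verts \<Gamma> \<Longrightarrow>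
      \<exists>N. \<forall>m\<ge>N. \<forall>n\<ge>N. (a m, b n) \<in> connected_avoiding \<Gamma> S"
    and minus: "\<And>S. finite S \<Longrightarrow> S \<subseteq> verts \<Gamma> \<Longrightarrow>
      \<exists>N. \<forall>m\<le>N. \<forall>n\<le>N. (a m, b n) \<in> connected_avoiding \<Gamma> S"
    and sep: "finite S\<^sub>0" "S\<^sub>0 \<subseteq> verts \<Gamma>"
      "\<And>m n. m \<ge> N\<^sub>0 \<Longrightarrow> n \<le> - N\<^sub>0 \<Longrightarrow> (a m, a n) \<notin> connected_avoiding \<Gamma> S\<^sub>0"
  shows "\<exists>C. hamilton_circle \<Gamma> C"
proof -
  have inja: "inj a" and injb: "inj b" and av: "\<And>k. a k \<in> verts \<Gamma>"
    and ae: "\<And>k. {a k, a (k + 1)} \<in> edges \<Gamma>"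
    using a b unfolding double_rays_def by auto
  define r q where "r = (\<lambda>n. a (int n))" and "q = (\<lambda>n. a (- int n))"
  have r: "r \<in> rays \<Gamma>"
    unfolding rays_def r_def using inja av ae[of "int _"]
    by (auto intro!: injI dest: injD simp: add.commute)
  have "{a (- int n), a (- int (Suc n))} \<in> edges \<Gamma>" for n
    using ae[of "- int (Suc n)"] by (simp add: insert_commute)
  then have q: "q \<in> rays \<Gamma>"
    unfolding rays_def q_def using inja av by (auto intro!: injI dest: injD)
  define \<omega> \<omega>' where "\<omega> = ray_equiv \<Gamma> `` {r}" and "\<omega>' = ray_equiv \<Gamma> `` {q}"
  have ends: "\<omega> \<in> graph_ends \<Gamma>" "\<omega>' \<in> graph_ends \<Gamma>"
    unfolding graph_ends_def \<omega>_def \<omega>'_def using r q by (auto intro: quotientI)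
  have ne: "\<omega> \<noteq> \<omega>'"
  proof
    assume "\<omega> = \<omega>'"
    then have "(r, q) \<in> ray_equiv \<Gamma>"
      unfolding \<omega>_def \<omega>'_def using q by (simp add: eq_equiv_class_iff[OF equiv_ray_equiv r q])
    from ray_equivD[OF this sep(1,2)] obtain N
      where N: "\<And>m n. m \<ge> N \<Longrightarrow> n \<ge> N \<Longrightarrow> (r m, q n) \<in> connected_avoiding \<Gamma> S\<^sub>0" by metis
    have "(r (max N (nat N\<^sub>0)), q (max N (nat N\<^sub>0))) \<in> connected_avoiding \<Gamma> S\<^sub>0"
      by (rule N) simp_all
    moreover have "(r (max N (nat N\<^sub>0)), q (max N (nat N\<^sub>0))) \<notin> connected_avoiding \<Gamma> S\<^sub>0"
      unfolding r_def q_def by (rule sep(3)) linarith+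
    ultimately show False by contradiction
  qed
  have cplus: "\<exists>N. \<forall>k\<ge>N. a k \<in> end_component \<Gamma> S \<omega> \<and> b k \<in> end_component \<Gamma> S \<omega>"
    if S: "finite S" "S \<subseteq> verts \<Gamma>" for S
  proof -
    obtain N where N: "\<And>m n. m \<ge> N \<Longrightarrow> n \<ge> N \<Longrightarrow> (a m, b n) \<in> connected_avoiding \<Gamma> S"
      using plus[OF S] by auto
    have bb: "b n \<in> end_component \<Gamma> S \<omega>" if "n \<ge> N" for n
    proof -
      have "\<forall>m\<ge>nat N. (b n, r m) \<in> connected_avoiding \<Gamma> S"
        unfolding r_def using that by (auto intro!: connected_avoiding_sym[OF N])
      then show ?thesis
        unfolding \<omega>_def end_component_class[OF ray_equiv_refl[OF r] S] by blast
    qed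
    have "a m \<in> end_component \<Gamma> S \<omega>" if "m \<ge> N" for m
      by (rule end_component_closed[OF bb[of N] connected_avoiding_sym[OF N]]) (use that in simp_all)
    with bb show ?thesis by blast
  qed
  have cminus: "\<exists>N. \<forall>k\<le>N. a k \<in> end_component \<Gamma> S \<omega>' \<and> b k \<in> end_component \<Gamma> S \<omega>'"
    if S: "finite S" "S \<subseteq> verts \<Gamma>" for S
  proof -
    obtain N where N: "\<And>m n. m \<le> N \<Longrightarrow> n \<le> N \<Longrightarrow> (a m, b n) \<in> connected_avoiding \<Gamma> S"
      using minus[OF S] by auto
    have bb: "b n \<in> end_component \<Gamma> S \<omega>'" if "n \<le> N" for n
    proof -
      have "\<forall>m\<ge>nat (- N). (b n, q m) \<in> connected_avoiding \<Gamma> S"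
        unfolding q_def using that by (auto intro!: connected_avoiding_sym[OF N])
      then show ?thesis
        unfolding \<omega>'_def end_component_class[OF ray_equiv_refl[OF q] S] by blast
    qed
    have "a m \<in> end_component \<Gamma> S \<omega>'" if "m \<le> N" for m
      by (rule end_component_closed[OF bb[of N] connected_avoiding_sym[OF N]]) (use that in simp_all)
    with bb show ?thesis by blast
  qed
  let ?f = "circle_map a b \<omega> \<omega>'"
  have cont: "continuous_map (top_of_set (sphere 0 1)) (freudenthal \<Gamma>) ?f"
    by (rule continuous_circle_map[OF a b ends cplus cminus])
  have inj: "inj_on ?f (sphere 0 1)"
    by (rule inj_on_circle_map[OF inja injb disj ne])
  have "embedding_map (top_of_set (sphere 0 1)) (freudenthal \<Gamma>) ?f"
    by (rule continuous_imp_embedding_map[OF cont])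
      (use inj in \<open>simp_all add: compact_space_subtopology Hausdorff_freudenthal\<close>)
  from embedding_map_imp_homeomorphic_space[OF this]
  have "subtopology (freudenthal \<Gamma>) (?f ` sphere 0 1) homeomorphic_space top_of_set (sphere (0::complex) 1)"
    by (subst homeomorphic_space_sym) simp
  moreover have "?f ` sphere 0 1 \<subseteq> topspace (freudenthal \<Gamma>)"
    using continuous_map_image_subset_topspace[OF cont] by simp
  moreover have "Complex_Point (vertex_point v) \<in> ?f ` sphere 0 1" if "v \<in> verts \<Gamma>" for v
  proof -
    \<comment> \<open>Normalising \<open>(s, 1)\<close> gives a point of the upper half circle with
      slope \<open>s\<close>.\<close>
    have *: "\<exists>z\<in>sphere 0 1. Im z > 0 \<and> Re z / Im z = s" for s :: real
    proof (intro bexI conjI)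
      let ?z = "Complex (s / sqrt (1 + s\<^sup>2)) (1 / sqrt (1 + s\<^sup>2))"
      have pos: "1 + s\<^sup>2 > 0" by (simp add: add_pos_nonneg)
      show "?z \<in> sphere 0 1"
        using pos by (simp add: cmod_def power_divide flip: add_divide_distrib)
      show "Im ?z > 0" "Re ?z / Im ?z = s" using pos by simp_all
    qed
    from that cover consider k where "v = a k" | k where "v = b k" by blast
    then show ?thesis
    proof cases
      case 1
      from *[of "of_int k"] obtain z where "z \<in> sphere 0 1" "Im z > 0" "Re z / Im z = of_int k" by blast
      then show ?thesis
        by (intro image_eqI[of _ _ z]) (simp_all add: circle_map_def path_point_of_int[OF inja] 1)
    next
      case 2
      from *[of "of_int k"] obtain z where "z \<in> sphere 0 1" "Im z > 0" "Re z / Im z = of_int k" by blast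
      \<comment> \<open>The lower half circle uses the negated slope, so the conjugate point has
        parameter \<open>k\<close> on \<open>b\<close>.\<close>
      then show ?thesis
        by (intro image_eqI[of _ _ "cnj z"]) (simp_all add: circle_map_def path_point_of_int[OF injb] 2)
    qed
  qed
  ultimately show ?thesis
    unfolding hamilton_circle_def by blast
qed

end

section \<open>Layered graphs\<close>

text \<open>The forward half iterates \<open>F\<close>; the backward half chooses preimages.
  \<open>P\<close> is the invariant under which \<open>bwd\<close> provides them.\<close>

lemma bi_infinite_recursion:
  fixes P :: "int \<Rightarrow> 'a \<Rightarrow> bool"
  assumes start: "P 0 x\<^sub>0"
    and fwd: "\<And>j x. P j x \<Longrightarrow> P (j + 1) (F j x)"
    and bwd: "\<And>j z. P (j + 1) z \<Longrightarrow> \<exists>x. P j x \<and> F j x = z"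
  shows "\<exists>x. \<forall>j. P j (x j) \<and> x (j + 1) = F j (x j)"
proof -
  \<comment> \<open>The clause for \<open>n = 0\<close> fixes the common starting value at which the
    two halves are glued.\<close>
  have "\<exists>u. \<forall>n. (P (int n) (u n) \<and> (n = 0 \<longrightarrow> u n = x\<^sub>0)) \<and> u (Suc n) = F (int n) (u n)"
    by (rule dependent_nat_choice) (use start fwd[of "int _"] in \<open>auto simp: add.commute\<close>)
  then obtain u where u: "\<And>n. P (int n) (u n)" "u 0 = x\<^sub>0" "\<And>n. u (Suc n) = F (int n) (u n)"
    by auto
  have "\<exists>w. \<forall>n. (P (- int n) (w n) \<and> (n = 0 \<longrightarrow> w n = x\<^sub>0)) \<and> F (- int (Suc n)) (w (Suc n)) = w n"
  proof (rule dependent_nat_choice)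
    fix x n assume "P (- int n) x \<and> (n = 0 \<longrightarrow> x = x\<^sub>0)"
    then show "\<exists>y. (P (- int (Suc n)) y \<and> (Suc n = 0 \<longrightarrow> y = x\<^sub>0)) \<and> F (- int (Suc n)) y = x"
      using bwd[of "- int (Suc n)" x] by simp
  qed (use start in auto)
  then obtain w where w: "\<And>n. P (- int n) (w n)" "w 0 = x\<^sub>0"
      "\<And>n. F (- int (Suc n)) (w (Suc n)) = w n"
    by auto
  define x where "x = (\<lambda>j. if j \<ge> 0 then u (nat j) else w (nat (- j)))"
  have x_minus: "x (- int n) = w n" for n
    using u(2) w(2) by (simp add: x_def)
  have "P j (x j) \<and> x (j + 1) = F j (x j)" for j
  proof (cases "j \<ge> 0")
    case True
    then obtain n where "j = int n" using zero_le_imp_eq_int by blast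
    then show ?thesis using u by (simp add: x_def nat_add_distrib)
  next
    case False
    define n where "n = nat (- j - 1)"
    have j: "j = - int (Suc n)" "j + 1 = - int n" using False by (simp_all add: n_def)
    have "x j = w (Suc n)" "x (j + 1) = w n"
      unfolding j(2) unfolding j(1) by (rule x_minus)+
    then show ?thesis
      using w(1)[of "Suc n"] w(3)[of n] unfolding j(1)[symmetric] by simp
  qed
  then show ?thesis by blast
qed

section \<open>Tilings of the integers by intervals, and arcs of a cycle\<close>

lemma step_less_imp_less:
  fixes t :: "int \<Rightarrow> int"
  assumes step: "\<And>j. t j < t (j + 1)" and "i < j"
  shows "t i < t j"
  using assms(2)
proof (induction j rule: int_gr_induct)
  case base
  then show ?case by (rule step)
next
  case (step j)
  with assms(1)[of j] show ?case by simp
qed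

text \<open>An increasing sequence of integers is unbounded on both sides. The induction starts at
  \<open>t 0\<close> and moves \<open>k\<close> by one, which moves the interval by at most
  one.\<close>

lemma ex_interval_index:
  fixes t :: "int \<Rightarrow> int"
  assumes step: "\<And>j. t j < t (j + 1)"
  shows "\<exists>J. \<forall>k. t (J k) \<le> k \<and> k < t (J k + 1)"
proof -
  have "\<exists>j. t j \<le> k \<and> k < t (j + 1)" for k
  proof (induction k rule: int_induct[of _ "t 0"])
    case base
    show ?case using step[of 0] by (intro exI[of _ 0]) simp
  next
    case (step1 k)
    then obtain j where j: "t j \<le> k" "k < t (j + 1)" by blast
    show ?case
    proof (cases "k + 1 < t (j + 1)")
      case True
      with j show ?thesis by (intro exI[of _ j]) simp
    next
      case False
      with j step[of "j + 1"] show ?thesis by (intro exI[of _ "j + 1"]) simp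
    qed
  next
    case (step2 k)
    then obtain j where j: "t j \<le> k" "k < t (j + 1)" by blast
    show ?case
    proof (cases "t j \<le> k - 1")
      case True
      with j show ?thesis by (intro exI[of _ j]) simp
    next
      case False
      with j step[of "j - 1"] show ?thesis by (intro exI[of _ "j - 1"]) simp
    qed
  qed
  then show ?thesis by metis
qed

lemma interval_index_unique:
  fixes t :: "int \<Rightarrow> int"
  assumes step: "\<And>j. t j < t (j + 1)"
    and "t i \<le> k" "k < t (i + 1)" "t j \<le> k" "k < t (j + 1)"
  shows "i = j"
proof -
  have le: "t (i + 1) \<le> t j" if "i < j" for i j
    using step_less_imp_less[of t "i + 1" j] step that by (cases "i + 1 = j") auto
  show ?thesis
    using le[of i j] le[of j i] assms(2-5) by linarith
qed

lemma mod_diff_cases: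
  fixes n :: int
  assumes "0 \<le> u" "u < n" "0 \<le> v" "v < n"
  shows "(u - v) mod n = (if v \<le> u then u - v else u - v + n)"
proof (cases "v \<le> u")
  case True
  with assms show ?thesis by simp
next
  case False
  have "(u - v) mod n = (u - v + n) mod n" by simp
  also have "\<dots> = u - v + n" using False assms by (intro mod_pos_pos_trivial) linarith+
  finally show ?thesis using False by simp
qed

text \<open>\<open>(i - x) mod n\<close> counts the steps from \<open>x\<close> to \<open>i\<close>
  along the cycle. Either \<open>i\<close> is met from \<open>x\<close> before \<open>y\<close>, or
  from \<open>y\<close> before \<open>x\<close>, never both.\<close>

lemma arcs_complementary:
  fixes n :: int
  assumes "0 \<le> i" "i < n" "0 \<le> x" "x < n" "0 \<le> y" "y < n" "x \<noteq> y"
  shows "(i - y) mod n < (x - y) mod n \<longleftrightarrow> \<not> (i - x) mod n < (y - x) mod n"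
  using assms by (simp add: mod_diff_cases)

lemma mod_add_left_inject:
  fixes n :: int
  assumes "(x + d) mod n = (x + d') mod n" "0 \<le> d" "d < n" "0 \<le> d'" "d' < n"
  shows "d = d'"
proof -
  have "n dvd d - d'"
    using assms(1) by (metis add_diff_cancel_left mod_eq_dvd_iff)
  then show ?thesis
    using assms(2-5) by (metis mod_eq_dvd_iff mod_pos_pos_trivial)
qed

text \<open>\<open>j\<close> numbers the layers in their order of traversal and \<open>i\<close> the
  positions on the cycle of a layer. \<open>\<sigma> j\<close> is an arbitrary permutation, since a
  matching need not respect the cycles; \<open>2 \<le> n\<close> leaves room for two entry
  points.\<close>

locale layered_ugraph = simple_ugraph \<Gamma> for \<Gamma> :: "'v ugraph" +
  fixes v :: "int \<Rightarrow> int \<Rightarrow> 'v" and n :: int and \<sigma> :: "int \<Rightarrow> int \<Rightarrow> int"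
  assumes two_le_n: "2 \<le> n"
    and v_bij: "bij_betw (\<lambda>(j, i). v j i) (UNIV \<times> {0..<n}) (verts \<Gamma>)"
    and layer_edge: "\<And>j i. i \<in> {0..<n} \<Longrightarrow> {v j i, v j ((i + 1) mod n)} \<in> edges \<Gamma>"
    and \<sigma>_bij: "\<And>j. bij_betw (\<sigma> j) {0..<n} {0..<n}"
    and matching_edge: "\<And>j i. i \<in> {0..<n} \<Longrightarrow> {v j i, v (j + 1) (\<sigma> j i)} \<in> edges \<Gamma>"
begin

lemma v_in_verts: "i \<in> {0..<n} \<Longrightarrow> v j i \<in> verts \<Gamma>"
  using bij_betwE[OF v_bij] by auto

lemma v_inject:
  assumes "v j i = v j' i'" "i \<in> {0..<n}" "i' \<in> {0..<n}"
  shows "j = j' \<and> i = i'"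
  using inj_onD[OF bij_betw_imp_inj_on[OF v_bij], of "(j, i)" "(j', i')"] assms by simp

lemma verts_eq: "verts \<Gamma> = {v j i | j i. i \<in> {0..<n}}"
  unfolding bij_betw_imp_surj_on[OF v_bij, symmetric] by force

definition entry_sequence :: "(int \<Rightarrow> int) \<Rightarrow> (int \<Rightarrow> int) \<Rightarrow> bool" where
  "entry_sequence x y \<longleftrightarrow> (\<forall>j. x j \<in> {0..<n} \<and> y j \<in> {0..<n} \<and> x j \<noteq> y j \<and>
     x (j + 1) = \<sigma> j ((y j - 1) mod n) \<and> y (j + 1) = \<sigma> j ((x j - 1) mod n))"

lemma entry_sequence_swap: "entry_sequence x y \<Longrightarrow> entry_sequence y x"
  unfolding entry_sequence_def by metis

text \<open>The shift along the cycle and \<open>\<sigma> j\<close> are bijections, so distinct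
  pairs stay distinct and every such pair has a predecessor: the recursion runs both ways.\<close>

lemma ex_entry_sequence: "\<exists>x y. entry_sequence x y"
proof -
  let ?P = "\<lambda>p. fst p \<in> {0..<n} \<and> snd p \<in> {0..<n} \<and> fst p \<noteq> snd p"
  let ?F = "\<lambda>j p. (\<sigma> j ((snd p - 1) mod n), \<sigma> j ((fst p - 1) mod n))"
  have modn: "k mod n \<in> {0..<n}" for k
    using two_le_n by simp
  have "\<exists>p. \<forall>j. ?P (p j) \<and> p (j + 1) = ?F j (p j)"
  proof (rule bi_infinite_recursion)
    show "?P (0, 1)" using two_le_n by simp
  next
    fix j p assume p: "?P p"
    have "(snd p - 1) mod n \<noteq> (fst p - 1) mod n"
    proof
      assume "(snd p - 1) mod n = (fst p - 1) mod n"
      then have "(-1 + snd p) mod n = (-1 + fst p) mod n" by simp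
      from mod_add_left_inject[OF this] p show False by auto
    qed
    then have "\<sigma> j ((snd p - 1) mod n) \<noteq> \<sigma> j ((fst p - 1) mod n)"
      using inj_onD[OF bij_betw_imp_inj_on[OF \<sigma>_bij]] modn by metis
    then show "?P (?F j p)"
      using bij_betwE[OF \<sigma>_bij] modn by simp
  next
    fix j p assume p: "?P p"
    then obtain c d where c: "c \<in> {0..<n}" "fst p = \<sigma> j c" and d: "d \<in> {0..<n}" "snd p = \<sigma> j d"
      using bij_betw_imp_surj_on[OF \<sigma>_bij, of j] by (metis imageE)
    have "(1 + d) mod n \<noteq> (1 + c) mod n"
    proof
      assume "(1 + d) mod n = (1 + c) mod n"
      from mod_add_left_inject[OF this] c d p show False by auto
    qed
    moreover have "((1 + c) mod n - 1) mod n = c" "((1 + d) mod n - 1) mod n = d"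
      using c d by (simp_all add: mod_diff_left_eq)
    ultimately show "\<exists>q. ?P q \<and> ?F j q = p"
      using c d modn by (intro exI[of _ "((1 + d) mod n, (1 + c) mod n)"]) (simp add: prod_eq_iff)
  qed
  then obtain p where "\<And>j. ?P (p j)" "\<And>j. p (j + 1) = ?F j (p j)" by metis
  then have "entry_sequence (fst \<circ> p) (snd \<circ> p)"
    unfolding entry_sequence_def by simp
  then show ?thesis by blast
qed

text \<open>The double ray that enters layer \<^term>\<open>j\<close> at \<^term>\<open>x j\<close>, follows the cycle up to the predecessor
  of \<^term>\<open>y j\<close>, and crosses to the next layer from there.\<close>
lemma entry_sequence_double_ray:
  assumes entry: "entry_sequence x y"
  shows "\<exists>a\<in>double_rays \<Gamma>.
    range a = {v j i | j i. i \<in> {0..<n} \<and> (i - x j) mod n < (y j - x j) mod n} \<and>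
    (\<forall>j. \<exists>N. \<forall>k\<ge>N. \<exists>j'\<ge>j. \<exists>i\<in>{0..<n}. a k = v j' i) \<and>
    (\<forall>j. \<exists>N. \<forall>k\<le>N. \<exists>j'\<le>j. \<exists>i\<in>{0..<n}. a k = v j' i)"
proof -
  have xy: "x j \<in> {0..<n}" "y j \<in> {0..<n}" "x j \<noteq> y j" "x (j + 1) = \<sigma> j ((y j - 1) mod n)" for j
    using entry unfolding entry_sequence_def by auto
  \<comment> \<open>The number of vertices visited in layer \<open>j\<close>: positive because the
    entry points differ, and below \<open>n\<close>, which leaves a vertex for the other
    ray.\<close>
  define len where "len j = (y j - x j) mod n" for j
  have len: "0 < len j" "len j < n" for j
    using xy[of j] by (auto simp: len_def mod_diff_cases)
  \<comment> \<open>\<open>t j\<close> is the parameter at which layer \<open>j\<close> is entered,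
    so the ray stays in it until \<open>t (j + 1) - 1\<close>.\<close>
  have "\<exists>t. \<forall>j. True \<and> t (j + 1) = t j + len j"
    by (rule bi_infinite_recursion[of "\<lambda>_ _. True" 0]) (auto intro: diff_add_cancel)
  then obtain t where t: "\<And>j. t (j + 1) = t j + len j" by auto
  have step: "t j < t (j + 1)" for j using t len[of j] by simp
  obtain J where J: "\<And>k. t (J k) \<le> k" "\<And>k. k < t (J k + 1)"
    using ex_interval_index[of t, OF step] by blast
  have J_eq: "J k = j" if "t j \<le> k" "k < t (j + 1)" for j k
    by (rule interval_index_unique[of t, OF step J that])
  define pos where "pos k = (x (J k) + (k - t (J k))) mod n" for k
  define a where "a k = v (J k) (pos k)" for k
  have pos: "pos k \<in> {0..<n}" for k
    unfolding pos_def using two_le_n by simp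
  have off: "0 \<le> k - t (J k)" "k - t (J k) < len (J k)" for k
    using J[of k] t[of "J k"] by simp_all
  have "inj a"
  proof (rule injI)
    fix k l assume "a k = a l"
    then have eq: "J k = J l" "pos k = pos l"
      using v_inject[OF _ pos pos, of "J k" k "J l" l] unfolding a_def by simp_all
    \<comment> \<open>Offsets within a layer are below \<open>len (J k) < n\<close>, so positions
      modulo \<open>n\<close> determine them.\<close>
    have "k - t (J k) = l - t (J k)"
      by (rule mod_add_left_inject[of "x (J k)" _ n])
        (use eq off[of k] off[of l] len[of "J k"] in \<open>simp_all add: pos_def\<close>)
    then show "k = l" by simp
  qed
  moreover have "{a k, a (k + 1)} \<in> edges \<Gamma>" for k
  proof (cases "k + 1 < t (J k + 1)")
    case True
    then have "J (k + 1) = J k"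
      using J[of k] by (intro J_eq) simp_all
    moreover from this have "pos (k + 1) = (x (J k) + (k - t (J k)) + 1) mod n"
      unfolding pos_def by (simp add: algebra_simps)
    then have "pos (k + 1) = (pos k + 1) mod n"
      unfolding pos_def by (simp only: mod_add_left_eq)
    ultimately show ?thesis
      unfolding a_def using layer_edge[OF pos] by simp
  next
    case False
    then have k: "k + 1 = t (J k + 1)" using J(2)[of k] by simp
    have J1: "J (k + 1) = J k + 1"
      using k step[of "J k + 1"] by (intro J_eq) simp_all
    \<comment> \<open>The last offset of the stay; its position is the predecessor of the other
      entry point.\<close>
    have "k - t (J k) = len (J k) - 1" using k t[of "J k"] by simp
    then have "pos k = (x (J k) + ((y (J k) - x (J k)) mod n - 1)) mod n"
      unfolding pos_def len_def by simp
    also have "\<dots> = (y (J k) - 1) mod n"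
      using mod_add_right_eq[of "x (J k) - 1" "y (J k) - x (J k)" n] by (simp add: algebra_simps)
    finally have "\<sigma> (J k) (pos k) = x (J k + 1)" using xy(4) by simp
    moreover have "pos (k + 1) = x (J k + 1)"
      using xy(1)[of "J k + 1"] unfolding pos_def J1 unfolding k by simp
    ultimately show ?thesis
      unfolding a_def J1 using matching_edge[OF pos] by metis
  qed
  ultimately have "a \<in> double_rays \<Gamma>"
    unfolding double_rays_def using v_in_verts[OF pos] by (auto simp: a_def)
  moreover have "range a = {v j i | j i. i \<in> {0..<n} \<and> (i - x j) mod n < (y j - x j) mod n}"
  proof (intro equalityI subsetI)
    fix w assume "w \<in> range a"
    then obtain k where k: "w = a k" by blast
    have "(pos k - x (J k)) mod n = (k - t (J k)) mod n"
      unfolding pos_def by (simp add: mod_diff_left_eq)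
    also have "\<dots> = k - t (J k)"
      using off[of k] len[of "J k"] by simp
    also have "\<dots> < len (J k)" by (rule off)
    finally show "w \<in> {v j i | j i. i \<in> {0..<n} \<and> (i - x j) mod n < (y j - x j) mod n}"
      using pos unfolding k a_def len_def by blast
  next
    fix w assume "w \<in> {v j i | j i. i \<in> {0..<n} \<and> (i - x j) mod n < (y j - x j) mod n}"
    then obtain j i where w: "w = v j i" and i: "i \<in> {0..<n}" and lt: "(i - x j) mod n < len j"
      unfolding len_def by blast
    define k where "k = t j + (i - x j) mod n"
    have "J k = j"
      using lt t[of j] two_le_n by (intro J_eq) (simp_all add: k_def)
    moreover from this have "pos k = i"
      using i by (simp add: pos_def k_def mod_add_right_eq)
    ultimately have "w = a k" by (simp add: w a_def)
    then show "w \<in> range a" by blast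
  qed
  moreover have "\<exists>N. \<forall>k\<ge>N. \<exists>j'\<ge>j. \<exists>i\<in>{0..<n}. a k = v j' i" for j
  proof -
    have "J k \<ge> j" if "k \<ge> t j" for k
    proof (rule ccontr)
      assume "\<not> J k \<ge> j"
      then have "t (J k + 1) \<le> t j"
        using step_less_imp_less[of t, OF step, of "J k + 1" j] by (cases "J k + 1 = j") auto
      with J(2)[of k] that show False by simp
    qed
    then show ?thesis using pos unfolding a_def by blast
  qed
  moreover have "\<exists>N. \<forall>k\<le>N. \<exists>j'\<le>j. \<exists>i\<in>{0..<n}. a k = v j' i" for j
  proof -
    have "J k \<le> j" if "k \<le> t j" for k
      using step_less_imp_less[of t, OF step, of j "J k"] J(1)[of k] that by (cases "J k \<le> j") auto
    then show ?thesis using pos unfolding a_def by blast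
  qed
  ultimately show ?thesis by blast
qed

section \<open>Connectivity of blocks of layers\<close>

lemma layer_connected:
  assumes avoid: "\<And>i. i \<in> {0..<n} \<Longrightarrow> v j i \<notin> S" and i: "i \<in> {0..<n}"
  shows "(v j 0, v j i) \<in> connected_avoiding \<Gamma> S"
proof -
  have "0 \<le> i" using i by simp
  then have "i < n \<longrightarrow> (v j 0, v j i) \<in> connected_avoiding \<Gamma> S"
  proof (induction i rule: int_ge_induct)
    case base
    show ?case
      using two_le_n by (auto intro!: connected_avoiding_refl v_in_verts avoid)
  next
    case (step i)
    show ?case
    proof
      assume lt: "i + 1 < n"
      have "(v j i, v j (i + 1)) \<in> connected_avoiding \<Gamma> S"
        using layer_edge[of i j] step.hyps lt
        by (intro connected_avoiding_edge) (auto intro!: v_in_verts avoid)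
      with step lt show "(v j 0, v j (i + 1)) \<in> connected_avoiding \<Gamma> S"
        using connected_avoiding_trans[of "v j 0" "v j i" \<Gamma> S "v j (i + 1)"] by simp
    qed
  qed
  then show ?thesis using i by simp
qed

text \<open>The matching edge from position 0 arrives at \<open>\<sigma> h 0\<close>, and the cycle
  of layer \<open>h + 1\<close> leads from there to position 0.\<close>

lemma layers_connected:
  assumes "l \<le> h" and "\<And>j i. l \<le> j \<Longrightarrow> j \<le> h \<Longrightarrow> i \<in> {0..<n} \<Longrightarrow> v j i \<notin> S"
  shows "(v l 0, v h 0) \<in> connected_avoiding \<Gamma> S"
  using assms
proof (induction h rule: int_ge_induct)
  case base
  show ?case
    by (rule layer_connected) (use base two_le_n in auto)
next
  case (step h)
  have 0: "0 \<in> {0..<n}" using two_le_n by simp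
  have \<sigma>0: "\<sigma> h 0 \<in> {0..<n}" using bij_betwE[OF \<sigma>_bij] 0 by blast
  have "(v l 0, v h 0) \<in> connected_avoiding \<Gamma> S"
    by (rule step.IH) (use step.prems in auto)
  moreover have "(v h 0, v (h + 1) (\<sigma> h 0)) \<in> connected_avoiding \<Gamma> S"
    using matching_edge[OF 0] v_in_verts 0 \<sigma>0 step.hyps step.prems[of h 0] step.prems[of "h + 1" "\<sigma> h 0"]
    by (intro connected_avoiding_edge) auto
  moreover have "(v (h + 1) (\<sigma> h 0), v (h + 1) 0) \<in> connected_avoiding \<Gamma> S"
    by (rule connected_avoiding_sym, rule layer_connected[OF _ \<sigma>0]) (use step in auto)
  ultimately show ?case
    by (rule connected_avoiding_trans[OF connected_avoiding_trans])
qed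

lemma interval_connected:
  assumes avoid: "\<And>l i. min j j' \<le> l \<Longrightarrow> l \<le> max j j' \<Longrightarrow> i \<in> {0..<n} \<Longrightarrow> v l i \<notin> S"
    and i: "i \<in> {0..<n}" "i' \<in> {0..<n}"
  shows "(v j i, v j' i') \<in> connected_avoiding \<Gamma> S"
proof -
  have "(v j i, v j 0) \<in> connected_avoiding \<Gamma> S"
    by (rule connected_avoiding_sym, rule layer_connected[OF _ i(1)]) (use avoid in auto)
  moreover have "(v j 0, v j' 0) \<in> connected_avoiding \<Gamma> S"
  proof (cases "j \<le> j'")
    case True
    then show ?thesis by (rule layers_connected) (use True avoid in auto)
  next
    case False
    then have "j' \<le> j" by simp
    then show ?thesis
      by (rule connected_avoiding_sym[OF layers_connected]) (use False avoid in auto)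
  qed
  moreover have "(v j' 0, v j' i') \<in> connected_avoiding \<Gamma> S"
    by (rule layer_connected[OF _ i(2)]) (use avoid in auto)
  ultimately show ?thesis
    by (rule connected_avoiding_trans[OF connected_avoiding_trans])
qed

lemma finite_meets_finitely_many_layers:
  assumes "finite S"
  shows "\<exists>M. \<forall>j. \<forall>i\<in>{0..<n}. v j i \<in> S \<longrightarrow> \<bar>j\<bar> < M"
proof -
  let ?w = "\<lambda>(j, i). v j i"
  have "finite (?w -` S \<inter> (UNIV \<times> {0..<n}))"
    by (rule finite_vimage_IntI[OF assms bij_betw_imp_inj_on[OF v_bij]])
  then have "finite ((\<lambda>p. \<bar>fst p\<bar>) ` (?w -` S \<inter> (UNIV \<times> {0..<n})))" by (rule finite_imageI)
  from bdd_above_finite[OF this]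
  obtain M where M: "\<And>m. m \<in> (\<lambda>p. \<bar>fst p\<bar>) ` (?w -` S \<inter> (UNIV \<times> {0..<n})) \<Longrightarrow> m \<le> M"
    by (auto elim!: bdd_above.E)
  have "\<bar>j\<bar> \<le> M" if "i \<in> {0..<n}" "v j i \<in> S" for i j
    by (rule M, rule image_eqI[of _ _ "(j, i)"]) (use that in auto)
  then have "\<forall>j. \<forall>i\<in>{0..<n}. v j i \<in> S \<longrightarrow> \<bar>j\<bar> < M + 1"
    by (simp add: zless_add1_eq le_less)
  then show ?thesis ..
qed

text \<open>The locale admits further edges between distant layers and so does not force two ends.
  \<open>sep\<close> excludes a connection between the two sides and is transferred to the tails of
  \<open>a\<close>.\<close>

theorem layered_hamilton_circle:
  assumes S\<^sub>0: "finite S\<^sub>0" "S\<^sub>0 \<subseteq> verts \<Gamma>"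
    and sep: "\<And>j k i i'. j \<ge> M\<^sub>0 \<Longrightarrow> k \<le> - M\<^sub>0 \<Longrightarrow> i \<in> {0..<n} \<Longrightarrow> i' \<in> {0..<n} \<Longrightarrow>
      (v j i, v k i') \<notin> connected_avoiding \<Gamma> S\<^sub>0"
  shows "\<exists>C. hamilton_circle \<Gamma> C"
proof -
  obtain x y where xy: "entry_sequence x y" using ex_entry_sequence by blast
  obtain a where a: "a \<in> double_rays \<Gamma>"
    and ra: "range a = {v j i | j i. i \<in> {0..<n} \<and> (i - x j) mod n < (y j - x j) mod n}"
    and a_plus: "\<And>j. \<exists>N. \<forall>k\<ge>N. \<exists>j'\<ge>j. \<exists>i\<in>{0..<n}. a k = v j' i"
    and a_minus: "\<And>j. \<exists>N. \<forall>k\<le>N. \<exists>j'\<le>j. \<exists>i\<in>{0..<n}. a k = v j' i"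
    using entry_sequence_double_ray[OF xy] by auto
  obtain b where b: "b \<in> double_rays \<Gamma>"
    and rb: "range b = {v j i | j i. i \<in> {0..<n} \<and> (i - y j) mod n < (x j - y j) mod n}"
    and b_plus: "\<And>j. \<exists>N. \<forall>k\<ge>N. \<exists>j'\<ge>j. \<exists>i\<in>{0..<n}. b k = v j' i"
    and b_minus: "\<And>j. \<exists>N. \<forall>k\<le>N. \<exists>j'\<le>j. \<exists>i\<in>{0..<n}. b k = v j' i"
    using entry_sequence_double_ray[OF entry_sequence_swap[OF xy]] by auto
  have compl: "(i - y j) mod n < (x j - y j) mod n \<longleftrightarrow> \<not> (i - x j) mod n < (y j - x j) mod n"
    if "i \<in> {0..<n}" for i j
    using xy that unfolding entry_sequence_def by (intro arcs_complementary) auto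
  have disj: "range a \<inter> range b = {}"
  proof (rule equals0I)
    fix w assume w: "w \<in> range a \<inter> range b"
    then obtain j i where 1: "w = v j i" "i \<in> {0..<n}" "(i - x j) mod n < (y j - x j) mod n"
      unfolding ra by blast
    from w obtain j' i' where 2: "w = v j' i'" "i' \<in> {0..<n}" "(i' - y j') mod n < (x j' - y j') mod n"
      unfolding rb by blast
    from 1 2 have "j = j' \<and> i = i'" by (intro v_inject) simp_all
    with 1 2 compl[of i j] show False by simp
  qed
  have cover: "verts \<Gamma> = range a \<union> range b"
    unfolding verts_eq ra rb using compl by blast
  have plus: "\<exists>N. \<forall>k\<ge>N. \<forall>l\<ge>N. (a k, b l) \<in> connected_avoiding \<Gamma> S" if S: "finite S" for S
  proof -
    obtain M where M: "\<And>j i. i \<in> {0..<n} \<Longrightarrow> v j i \<in> S \<Longrightarrow> \<bar>j\<bar> < M"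
      using finite_meets_finitely_many_layers[OF S] by blast
    obtain N where N: "\<And>k. k \<ge> N \<Longrightarrow> \<exists>j'\<ge>M. \<exists>i\<in>{0..<n}. a k = v j' i" using a_plus[of M] by auto
    obtain N' where N': "\<And>k. k \<ge> N' \<Longrightarrow> \<exists>j'\<ge>M. \<exists>i\<in>{0..<n}. b k = v j' i" using b_plus[of M] by auto
    have "(a k, b l) \<in> connected_avoiding \<Gamma> S" if kl: "k \<ge> max N N'" "l \<ge> max N N'" for k l
    proof -
      obtain j i where j: "j \<ge> M" "i \<in> {0..<n}" "a k = v j i" using N[of k] kl by auto
      obtain j' i' where j': "j' \<ge> M" "i' \<in> {0..<n}" "b l = v j' i'" using N'[of l] kl by auto
      show ?thesis
        unfolding j j' by (rule interval_connected[OF _ j(2) j'(2)]) (use M j(1) j'(1) in fastforce)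
    qed
    then show ?thesis by blast
  qed
  have minus: "\<exists>N. \<forall>k\<le>N. \<forall>l\<le>N. (a k, b l) \<in> connected_avoiding \<Gamma> S" if S: "finite S" for S
  proof -
    obtain M where M: "\<And>j i. i \<in> {0..<n} \<Longrightarrow> v j i \<in> S \<Longrightarrow> \<bar>j\<bar> < M"
      using finite_meets_finitely_many_layers[OF S] by blast
    obtain N where N: "\<And>k. k \<le> N \<Longrightarrow> \<exists>j'\<le>-M. \<exists>i\<in>{0..<n}. a k = v j' i" using a_minus[of "-M"] by auto
    obtain N' where N': "\<And>k. k \<le> N' \<Longrightarrow> \<exists>j'\<le>-M. \<exists>i\<in>{0..<n}. b k = v j' i" using b_minus[of "-M"] by auto
    have "(a k, b l) \<in> connected_avoiding \<Gamma> S" if kl: "k \<le> min N N'" "l \<le> min N N'" for k l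
    proof -
      obtain j i where j: "j \<le> -M" "i \<in> {0..<n}" "a k = v j i" using N[of k] kl by auto
      obtain j' i' where j': "j' \<le> -M" "i' \<in> {0..<n}" "b l = v j' i'" using N'[of l] kl by auto
      show ?thesis
        unfolding j j' by (rule interval_connected[OF _ j(2) j'(2)]) (use M j(1) j'(1) in fastforce)
    qed
    then show ?thesis by blast
  qed
  obtain N where N: "\<And>k. k \<ge> N \<Longrightarrow> \<exists>j'\<ge>M\<^sub>0. \<exists>i\<in>{0..<n}. a k = v j' i" using a_plus[of M\<^sub>0] by auto
  obtain N' where N': "\<And>k. k \<le> N' \<Longrightarrow> \<exists>j'\<le>-M\<^sub>0. \<exists>i\<in>{0..<n}. a k = v j' i" using a_minus[of "-M\<^sub>0"] by auto
  \<comment> \<open>The threshold is symmetric, hence \<open>- N'\<close>: from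
    \<open>l \<le> - max N (- N')\<close> follows \<open>l \<le> N'\<close>.\<close>
  have "(a k, a l) \<notin> connected_avoiding \<Gamma> S\<^sub>0" if kl: "k \<ge> max N (- N')" "l \<le> - max N (- N')" for k l
  proof -
    obtain j i where j: "j \<ge> M\<^sub>0" "i \<in> {0..<n}" "a k = v j i" using N[of k] kl by auto
    obtain j' i' where j': "j' \<le> -M\<^sub>0" "i' \<in> {0..<n}" "a l = v j' i'" using N'[of l] kl(2) max.cobounded2[of "- N'" N] by (auto simp: max_def split: if_splits)
    show ?thesis unfolding j j' by (rule sep[OF j(1) j'(1) j(2) j'(2)])
  qed
  then show ?thesis
    by (intro hamilton_circle_of_double_rays[OF a b disj cover _ _ S\<^sub>0] plus minus)
qed

end

section \<open>Hamilton double rays of the integers\<close>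

definition snake_index :: "int \<Rightarrow> int \<Rightarrow> int" where
  "snake_index m i = (if even (i div m) then i mod m else m - 1 - i mod m)"

text \<open>Consecutive copies of the finite path \<^term>\<open>p\<close>, shifted by multiples of \<^term>\<open>y\<close> and traversed
  alternately forwards and backwards.\<close>
definition snake :: "(int \<Rightarrow> int) \<Rightarrow> int \<Rightarrow> int \<Rightarrow> int \<Rightarrow> int" where
  "snake p m y i = p (snake_index m i) + (i div m) * y"

lemma div_mod_succ:
  fixes i m :: int
  assumes "m > 0"
  shows "i mod m + 1 < m \<and> (i + 1) div m = i div m \<and> (i + 1) mod m = i mod m + 1 \<or>
    i mod m = m - 1 \<and> (i + 1) div m = i div m + 1 \<and> (i + 1) mod m = 0"
proof (cases "i mod m + 1 < m")
  case True
  have eq: "i + 1 = m * (i div m) + (i mod m + 1)" by simp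
  have "(i + 1) mod m = i mod m + 1"
    by (rule int_mod_pos_eq[OF eq]) (use True assms in simp_all)
  moreover have "(i + 1) div m = i div m"
    by (rule int_div_pos_eq[OF eq]) (use True assms in simp_all)
  ultimately show ?thesis using True by blast
next
  case False
  with assms have r: "i mod m = m - 1"
    using pos_mod_bound[of m i] by linarith
  have eq: "i + 1 = (i div m + 1) * m"
    using div_mult_mod_eq[of i m] r by (simp add: algebra_simps)
  have "(i + 1) div m = i div m + 1" "(i + 1) mod m = 0"
    unfolding eq using assms by simp_all
  with r show ?thesis by blast
qed

text \<open>As odd copies run backwards, consecutive copies meet at the same vertex of
  \<open>p\<close> up to the shift, and the connecting step is \<open>y\<close>. Backward steps are
  negated steps of \<open>p\<close>, hence the symmetry of \<open>Y\<close>.\<close>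

lemma snake_step:
  assumes "m > 0" and sym: "\<And>u. u \<in> Y \<Longrightarrow> - u \<in> Y" and "y \<in> Y"
    and p: "\<And>r. 0 \<le> r \<Longrightarrow> r + 1 < m \<Longrightarrow> p (r + 1) - p r \<in> Y"
  shows "snake p m y (i + 1) - snake p m y i \<in> Y"
  using div_mod_succ[OF assms(1), of i]
proof (elim disjE conjE)
  assume i: "i mod m + 1 < m" "(i + 1) div m = i div m" "(i + 1) mod m = i mod m + 1"
  have r: "0 \<le> i mod m" using assms(1) by simp
  show ?thesis
  proof (cases "even (i div m)")
    case True
    then show ?thesis
      using p[OF r i(1)] by (simp add: snake_def snake_index_def i)
  next
    case False
    have "p (m - 1 - i mod m) - p (m - 1 - (i mod m + 1)) \<in> Y"
      using p[of "m - 1 - (i mod m + 1)"] i(1) r by (simp add: diff_diff_eq add.commute)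
    from sym[OF this] show ?thesis
      using False by (simp add: snake_def snake_index_def i)
  qed
next
  assume i: "i mod m = m - 1" "(i + 1) div m = i div m + 1" "(i + 1) mod m = 0"
  show ?thesis
    using assms(3) unfolding snake_def snake_index_def i by (simp add: distrib_right)
qed

text \<open>For positive \<open>d\<close> dividing \<open>a\<close>: a Hamilton path in the subgroup
  generated by \<open>d\<close> in the integers modulo \<open>a\<close>, with steps in
  \<open>Y\<close>, lifted to the integers. The subgroup has \<open>a div d\<close> elements, so
  pairwise incongruence means that all are visited.\<close>

definition residue_path :: "int set \<Rightarrow> int \<Rightarrow> int \<Rightarrow> (int \<Rightarrow> int) \<Rightarrow> bool" where
  "residue_path Y a d p \<longleftrightarrow>
     (\<forall>r\<in>{0..<a div d}. d dvd p r) \<and>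
     (\<forall>r. 0 \<le> r \<and> r + 1 < a div d \<longrightarrow> p (r + 1) - p r \<in> Y) \<and>
     (\<forall>r\<in>{0..<a div d}. \<forall>s\<in>{0..<a div d}. a dvd p r - p s \<longrightarrow> r = s)"

lemma snake_index_range:
  assumes "m > 0"
  shows "snake_index m i \<in> {0..<m}"
proof -
  obtain r where r: "r = i mod m" "0 \<le> r" "r < m"
    using assms by simp
  then show ?thesis
    unfolding snake_index_def r(1)[symmetric] by auto
qed

lemma snake_index_inject:
  assumes "snake_index m i = snake_index m j" and "i div m = j div m"
  shows "i = j"
proof -
  have "i mod m = j mod m"
    using assms by (auto simp: snake_index_def split: if_splits)
  then show ?thesis
    using assms(2) by (metis div_mult_mod_eq)
qed

text \<open>Adding \<open>y\<close> enlarges the multiples of \<open>d\<close> to the multiples of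
  \<open>gcd d y\<close>. The cosets are represented by \<open>k * y\<close> with
  \<open>0 \<le> k < d div gcd d y\<close>, and the snake runs through one after the other.\<close>

lemma residue_path_refine:
  assumes a: "a > 0" and d: "d > 0" "d dvd a" and sym: "\<And>u. u \<in> Y \<Longrightarrow> - u \<in> Y" and y: "y \<in> Y"
    and p: "residue_path Y a d p"
  shows "\<exists>p'. residue_path Y a (gcd d y) p'"
proof -
  define m where "m = a div d"
  define d' where "d' = gcd d y"
  define q where "q = d div d'"
  have m: "m > 0" "a = m * d"
    using a d unfolding m_def by (auto simp: pos_imp_zdiv_pos_iff zdvd_imp_le)
  have d': "d' > 0" "d' dvd d" "d' dvd y"
    using d(1) unfolding d'_def by auto
  have q: "d = q * d'" "q > 0"
    using d d' unfolding q_def by (auto simp: pos_imp_zdiv_pos_iff zdvd_imp_le)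
  obtain y' where y': "y = y' * d'"
    using d'(3) by (metis dvdE mult.commute)
  have cop: "coprime q y'"
  proof -
    have "d' = gcd q y' * d'"
      using d'_def d'(1) unfolding q(1) y' by (simp add: gcd_mult_distrib_int[symmetric] mult.commute)
    then show ?thesis using d'(1) by (simp add: coprime_iff_gcd_eq_1)
  qed
  have ad': "a div d' = m * q"
    using m(2) q(1) d'(1) by simp
  have pd: "\<And>r. r \<in> {0..<m} \<Longrightarrow> d dvd p r"
    and ps: "\<And>r. 0 \<le> r \<Longrightarrow> r + 1 < m \<Longrightarrow> p (r + 1) - p r \<in> Y"
    and pi: "\<And>r s. r \<in> {0..<m} \<Longrightarrow> s \<in> {0..<m} \<Longrightarrow> a dvd p r - p s \<Longrightarrow> r = s"
    using p unfolding residue_path_def m_def[symmetric] by simp_all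
  have "residue_path Y a d' (snake p m y)"
    unfolding residue_path_def ad'
  proof (intro conjI ballI allI impI)
    fix r
    have "d' dvd p (snake_index m r)"
      using pd[OF snake_index_range[OF m(1)]] d'(2) by (rule dvd_trans[rotated])
    then show "d' dvd snake p m y r"
      unfolding snake_def using d'(3) by simp
    show "snake p m y (r + 1) - snake p m y r \<in> Y"
      by (rule snake_step[of m Y y p, OF m(1) sym y ps])
  next
    fix r s assume r: "r \<in> {0..<m * q}" and s: "s \<in> {0..<m * q}"
      and eq: "a dvd snake p m y r - snake p m y s"
    define k l where "k = r div m" and "l = s div m"
    have div_range: "0 \<le> u div m \<and> u div m < q" if "u \<in> {0..<m * q}" for u
    proof -
      have "m * (u div m) \<le> u"
        using mult_div_mod_eq[of m u] pos_mod_sign[OF m(1), of u] by linarith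
      also have "u < m * q" using that by simp
      finally show ?thesis
        using that m(1) by (simp add: pos_imp_zdiv_nonneg_iff)
    qed
    have kl: "0 \<le> k" "k < q" "0 \<le> l" "l < q"
      using div_range[OF r] div_range[OF s] unfolding k_def l_def by simp_all
    have split: "snake p m y r - snake p m y s =
      (p (snake_index m r) - p (snake_index m s)) + (k - l) * y"
      unfolding snake_def k_def l_def by (simp add: algebra_simps)
    \<comment> \<open>Modulo \<open>d\<close> the values of \<open>p\<close> vanish, so the copy
      numbers can be compared first; they agree because \<open>q\<close> is coprime to
      \<open>y'\<close>.\<close>
    have "d dvd (p (snake_index m r) - p (snake_index m s)) + (k - l) * y"
      using dvd_trans[OF d(2) eq] unfolding split .
    then have "d dvd (k - l) * y"
      using pd[OF snake_index_range[OF m(1)]] by (metis dvd_add_right_iff dvd_diff)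
    then have "q dvd (k - l) * y'"
      unfolding q(1) y' using d'(1) by (simp add: mult.assoc[symmetric])
    then have "q dvd k - l"
      using cop by (simp add: coprime_dvd_mult_left_iff)
    then have kl_eq: "k = l"
      using kl by (metis mod_eq_dvd_iff mod_pos_pos_trivial)
    then have "a dvd p (snake_index m r) - p (snake_index m s)"
      using eq unfolding split by simp
    from pi[OF snake_index_range[OF m(1)] snake_index_range[OF m(1)] this]
    show "r = s" using kl_eq unfolding k_def l_def by (rule snake_index_inject)
  qed
  then show ?thesis unfolding d'_def by blast
qed

text \<open>Generators enter one at a time, starting from the single residue 0, which is the case
  \<open>d = a\<close>.\<close>

lemma ex_residue_path:
  assumes a: "a > 0" and sym: "\<And>u. u \<in> Y \<Longrightarrow> - u \<in> Y" and "finite Z" "Z \<subseteq> Y"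
  shows "\<exists>p. residue_path Y a (gcd a (Gcd Z)) p"
  using assms(3,4)
proof (induction Z rule: finite_induct)
  case empty
  have "residue_path Y a a (\<lambda>_. 0)"
    using a by (auto simp: residue_path_def)
  then show ?case using a by auto
next
  case (insert y Z)
  then obtain p where "residue_path Y a (gcd a (Gcd Z)) p" by auto
  from residue_path_refine[OF a _ _ sym _ this, of y] insert.prems a
  show ?case by (simp add: ac_simps)
qed

text \<open>\<open>gen\<close> expresses that \<open>Y\<close> generates the integers. Modulo a
  positive \<open>a\<close> in \<open>Y\<close> the residue path meets each class once; shifting by
  \<open>a\<close> preserves classes, so the copies cover each integer exactly once. The bound holds
  because copy \<open>k\<close> stays near \<open>k * a\<close>.\<close>

theorem int_hamilton_double_ray:
  fixes Y :: "int set"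
  assumes fin: "finite Y" and sym: "\<And>u. u \<in> Y \<Longrightarrow> - u \<in> Y"
    and gen: "\<And>d. (\<And>y. y \<in> Y \<Longrightarrow> d dvd y) \<Longrightarrow> d dvd 1"
  shows "\<exists>D :: int \<Rightarrow> int. bij D \<and> (\<forall>j. D (j + 1) - D j \<in> Y) \<and> (\<exists>B. \<forall>j. \<bar>D j - j\<bar> \<le> B)"
proof -
  obtain a where a: "a \<in> Y" "a > 0"
  proof -
    \<comment> \<open>Without a nonzero element in \<open>Y\<close>, 0 would divide all of
      \<open>Y\<close> and hence 1.\<close>
    obtain u where "u \<in> Y" "u \<noteq> 0" using gen[of 0] by auto
    then show ?thesis using that[of u] that[of "- u"] sym[of u] by (cases "u > 0") auto
  qed
  have "Gcd Y dvd 1" by (rule gen) (rule Gcd_dvd)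
  then have "gcd a (Gcd Y) = 1" by simp
  then obtain p where p: "residue_path Y a 1 p"
    using ex_residue_path[OF a(2) sym fin subset_refl] by metis
  have ps: "\<And>r. 0 \<le> r \<Longrightarrow> r + 1 < a \<Longrightarrow> p (r + 1) - p r \<in> Y"
    and pi: "\<And>r s. r \<in> {0..<a} \<Longrightarrow> s \<in> {0..<a} \<Longrightarrow> a dvd p r - p s \<Longrightarrow> r = s"
    using p unfolding residue_path_def by auto
  define D where "D = snake p a a"
  have step: "D (j + 1) - D j \<in> Y" for j
    unfolding D_def by (rule snake_step[of a Y a p, OF a(2) sym a(1) ps])
  have inj: "inj D"
  proof (rule injI)
    fix i j assume eq: "D i = D j"
    then have "p (snake_index a i) - p (snake_index a j) = (j div a - i div a) * a"
      unfolding D_def snake_def by (simp add: algebra_simps)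
    then have "a dvd p (snake_index a i) - p (snake_index a j)" by simp
    from pi[OF snake_index_range[OF a(2)] snake_index_range[OF a(2)] this]
    have ix: "snake_index a i = snake_index a j" .
    with eq have "i div a * a = j div a * a" unfolding D_def snake_def by simp
    then have "i div a = j div a" using a(2) by simp
    with ix show "i = j" by (rule snake_index_inject)
  qed
  have surj: "surj D"
  proof (unfold surj_def, rule allI)
    fix z
    \<comment> \<open>There are \<open>a\<close> pairwise incongruent values, so they exhaust the
      residues.\<close>
    have "inj_on (\<lambda>r. p r mod a) {0..<a}"
      by (rule inj_onI) (use pi in \<open>simp add: mod_eq_dvd_iff\<close>)
    then have "(\<lambda>r. p r mod a) ` {0..<a} = {0..<a}"
      using a(2) by (intro endo_inj_surj) auto
    then obtain r where r: "r \<in> {0..<a}" "z mod a = p r mod a"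
      using a(2) by (metis (no_types, lifting) atLeastLessThan_iff imageE pos_mod_bound pos_mod_sign)
    then obtain k where k: "z - p r = a * k"
      by (metis mod_eq_dvd_iff dvdE)
    \<comment> \<open>\<open>k\<close> is the copy and \<open>r\<close> the position on
      \<open>p\<close>, mirrored in odd copies.\<close>
    define i where "i = k * a + (if even k then r else a - 1 - r)"
    have "i div a = k"
      unfolding i_def using r(1) a(2) by auto
    moreover from this have "snake_index a i = r"
      unfolding snake_index_def using r(1) a(2) by (auto simp: i_def)
    ultimately have "D i = z"
      unfolding D_def snake_def using k by (simp add: algebra_simps)
    then show "\<exists>i. z = D i" by (intro exI[of _ i]) simp
  qed
  have "\<bar>D j - j\<bar> \<le> (\<Sum>r\<in>{0..<a}. \<bar>p r\<bar>) + a" for j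
  proof -
    have "\<bar>p (snake_index a j)\<bar> \<le> (\<Sum>r\<in>{0..<a}. \<bar>p r\<bar>)"
      using snake_index_range[OF a(2)] by (intro member_le_sum) auto
    moreover have "D j - j = p (snake_index a j) - j mod a"
      unfolding D_def snake_def using div_mult_mod_eq[of j a] by linarith
    moreover have "0 \<le> j mod a" "j mod a < a" using a(2) by simp_all
    ultimately show ?thesis by linarith
  qed
  with inj surj step show ?thesis unfolding bij_def by blast
qed

section \<open>Semidirect products with the integers\<close>

context group
begin

lemma simple_cayley_graph:
  assumes "S \<subseteq> carrier G"
  shows "simple_ugraph (cayley_graph G S)"
proof
  fix u v assume "{u, v} \<in> edges (cayley_graph G S)"
  then obtain g s where "g \<in> carrier G" "s \<in> S" "g \<otimes> s \<noteq> g" "{u, v} = {g, g \<otimes> s}"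
    unfolding cayley_graph_def by auto
  with assms show "u \<in> verts (cayley_graph G S) \<and> v \<in> verts (cayley_graph G S) \<and> u \<noteq> v"
    by (auto simp: cayley_graph_def doubleton_eq_iff)
qed

lemma cayley_graph_edgeI:
  "g \<in> carrier G \<Longrightarrow> s \<in> S \<Longrightarrow> g \<otimes> s \<noteq> g \<Longrightarrow> {g, g \<otimes> s} \<in> edges (cayley_graph G S)"
  unfolding cayley_graph_def by auto

text \<open>Left translations are automorphisms of a right Cayley graph; they carry the graph of
  \<open>H\<close> into every coset.\<close>

lemma cayley_graph_translate_subgroup:
  assumes "subgroup H G" and "X \<subseteq> H" and "X \<subseteq> S" and g: "g \<in> carrier G"
    and "{u, w} \<in> edges (cayley_graph (G\<lparr>carrier := H\<rparr>) X)"
  shows "{g \<otimes> u, g \<otimes> w} \<in> edges (cayley_graph G S)"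
proof -
  obtain h x where hx: "h \<in> H" "x \<in> X" "h \<otimes> x \<noteq> h" "{u, w} = {h, h \<otimes> x}"
    using assms(5) unfolding cayley_graph_def by auto
  have h: "h \<in> carrier G" and x: "x \<in> carrier G"
    using hx(1,2) assms(2) subgroup.mem_carrier[OF assms(1)] by auto
  have "{g \<otimes> h, g \<otimes> h \<otimes> x} \<in> edges (cayley_graph G S)"
    by (rule cayley_graph_edgeI) (use g h x hx assms(3) in \<open>auto simp: m_assoc\<close>)
  moreover have "{g \<otimes> u, g \<otimes> w} = (\<lambda>z. g \<otimes> z) ` {u, w}" by simp
  moreover have "\<dots> = {g \<otimes> h, g \<otimes> h \<otimes> x}"
    unfolding hx(4) using g h x by (simp add: m_assoc)
  ultimately show ?thesis by simp
qed

end

text \<open>\<open>e\<close> parametrises the factor isomorphic to the integers.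
  \<open>e_in_H\<close> contains the trivial intersection with \<open>H\<close> and, since
  \<open>\<one>\<close> lies in \<open>H\<close>, the injectivity of \<open>e\<close>.\<close>

locale semidirect_int = group G for G (structure) +
  fixes H :: "'a set" and e :: "int \<Rightarrow> 'a"
  assumes H_normal: "H \<lhd> G"
    and e_closed [simp]: "e k \<in> carrier G"
    and e_add: "e (k + l) = e k \<otimes> e l"
    and e_in_H: "e k \<in> H \<Longrightarrow> k = 0"
    and decomposition: "g \<in> carrier G \<Longrightarrow> \<exists>h\<in>H. \<exists>k. g = h \<otimes> e k"
begin

lemma H_subgroup: "subgroup H G"
  using H_normal by (rule normal_imp_subgroup)

lemma H_closed [simp]: "h \<in> H \<Longrightarrow> h \<in> carrier G"
  using H_subgroup by (rule subgroup.mem_carrier)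

lemma e_0 [simp]: "e 0 = \<one>"
  using e_add[of 0 0] by simp

lemma e_minus: "e (- k) = inv (e k)"
proof -
  have "e (- k) \<otimes> e k = \<one>" using e_add[of "- k" k] by simp
  then show ?thesis by (metis e_closed inv_equality)
qed

text \<open>The conjugation that arises when \<open>e k\<close> moves from the right of an element
  of \<open>H\<close> to its left.\<close>

definition twist :: "int \<Rightarrow> 'a \<Rightarrow> 'a" where
  "twist k h = inv (e k) \<otimes> h \<otimes> e k"

lemma twist_closed: "h \<in> H \<Longrightarrow> twist k h \<in> H"
  unfolding twist_def by (rule normal.inv_op_closed1[OF H_normal]) simp_all

lemma twist_commute: "h \<in> H \<Longrightarrow> h \<otimes> e k = e k \<otimes> twist k h"
  unfolding twist_def by (simp add: m_assoc[symmetric])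

lemma twist_minus: "h \<in> H \<Longrightarrow> twist (- k) (twist k h) = h"
  unfolding twist_def e_minus by (simp add: m_assoc) (simp add: m_assoc[symmetric])

lemma bij_twist: "bij_betw (twist k) H H"
  by (rule bij_betwI[of _ _ _ "twist (- k)"])
    (use twist_closed twist_minus[of _ k] twist_minus[of _ "- k"] in auto)

text \<open>With \<open>e k\<close> on the left, right multiplication by an element of
  \<open>H\<close> changes only the second factor, so the Hamilton cycle of \<open>H\<close> is
  translated without a twist.\<close>

lemma layer_decomposition:
  assumes "g \<in> carrier G"
  shows "\<exists>k. \<exists>h\<in>H. g = e k \<otimes> h"
proof -
  obtain h k where h: "h \<in> H" "g = h \<otimes> e k"
    using decomposition[OF assms] by auto
  then have "g = e k \<otimes> twist k h" by (simp add: twist_commute)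
  with twist_closed[OF h(1)] show ?thesis by auto
qed

lemma layer_unique:
  assumes eq: "e k \<otimes> h = e k' \<otimes> h'" and h: "h \<in> H" "h' \<in> H"
  shows "k = k' \<and> h = h'"
proof -
  have "e (k - k') = inv (e k') \<otimes> e k"
    using e_add[of "- k'" k] e_minus by simp
  also have "\<dots> = h' \<otimes> inv h"
  proof -
    have "e k = e k' \<otimes> h' \<otimes> inv h"
      using h by (simp add: eq[symmetric] m_assoc)
    then show ?thesis
      using h by (simp add: m_assoc) (simp add: m_assoc[symmetric])
  qed
  also have "\<dots> \<in> H"
    using h H_subgroup by (simp add: subgroup.m_closed subgroup.m_inv_closed)
  finally have "k = k'" using e_in_H by fastforce
  then show ?thesis using eq h by simp
qed

text \<open>The projection of \<open>G\<close> onto its quotient by \<open>H\<close>, read as an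
  integer.\<close>

definition level :: "'a \<Rightarrow> int" where
  "level g = (SOME k. \<exists>h\<in>H. g = e k \<otimes> h)"

lemma level_eq:
  assumes "h \<in> H"
  shows "level (e k \<otimes> h) = k"
  unfolding level_def
proof (rule some_equality)
  show "\<exists>h'\<in>H. e k \<otimes> h = e k \<otimes> h'" using assms by blast
  show "k' = k" if "\<exists>h'\<in>H. e k \<otimes> h = e k' \<otimes> h'" for k'
    using that layer_unique assms by blast
qed

lemma level_mult_H: "g \<in> carrier G \<Longrightarrow> h \<in> H \<Longrightarrow> level (g \<otimes> h) = level g"
proof -
  assume g: "g \<in> carrier G" and h: "h \<in> H"
  obtain k h' where kh: "h' \<in> H" "g = e k \<otimes> h'" using layer_decomposition[OF g] by blast
  then have "g \<otimes> h = e k \<otimes> (h' \<otimes> h)" using h by (simp add: m_assoc)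
  moreover have "h' \<otimes> h \<in> H" using kh h H_subgroup by (simp add: subgroup.m_closed)
  ultimately show ?thesis using kh by (simp add: level_eq)
qed

lemma level_mult_e: "g \<in> carrier G \<Longrightarrow> level (g \<otimes> e l) = level g + l"
proof -
  assume g: "g \<in> carrier G"
  obtain k h where kh: "h \<in> H" "g = e k \<otimes> h" using layer_decomposition[OF g] by blast
  then have "g \<otimes> e l = e (k + l) \<otimes> twist l h"
    using twist_closed by (simp add: m_assoc twist_commute e_add)
  then show ?thesis using kh twist_closed by (simp add: level_eq)
qed

lemma finite_levels:
  assumes "finite H"
  shows "finite {g \<in> carrier G. \<bar>level g\<bar> \<le> M}"
proof (rule finite_subset)
  show "{g \<in> carrier G. \<bar>level g\<bar> \<le> M} \<subseteq> (\<lambda>(k, h). e k \<otimes> h) ` ({-M..M} \<times> H)"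
  proof
    fix g assume g: "g \<in> {g \<in> carrier G. \<bar>level g\<bar> \<le> M}"
    then obtain k h where kh: "h \<in> H" "g = e k \<otimes> h" using layer_decomposition by blast
    then have "\<bar>k\<bar> \<le> M" using g by (simp add: level_eq)
    then show "g \<in> (\<lambda>(k, h). e k \<otimes> h) ` ({-M..M} \<times> H)" using kh by force
  qed
qed (use assms in simp)

text \<open>Edges from \<open>X\<close> keep the level and edges from \<open>Y\<close> change it by
  at most \<open>M\<close>, so no edge jumps over the strip of levels between \<open>- M\<close> and
  \<open>M\<close>.\<close>

lemma levels_separated:
  assumes X: "X \<subseteq> H" and Y: "\<And>y. y \<in> Y \<Longrightarrow> \<bar>y\<bar> \<le> M" and "0 \<le> M"
    and u: "M < level u" and w: "level w \<le> M"
  shows "(u, w) \<notin> connected_avoiding (cayley_graph G (X \<union> e ` Y)) {g \<in> carrier G. \<bar>level g\<bar> \<le> M}"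
proof
  let ?\<Gamma> = "cayley_graph G (X \<union> e ` Y)" and ?S = "{g \<in> carrier G. \<bar>level g\<bar> \<le> M}"
  have step: "\<bar>level b - level a\<bar> \<le> M" if ab: "{a, b} \<in> edges ?\<Gamma>" for a b
  proof -
    obtain g s where gs: "g \<in> carrier G" "s \<in> X \<union> e ` Y" "{a, b} = {g, g \<otimes> s}"
      using ab unfolding cayley_graph_def by auto
    have "\<bar>level (g \<otimes> s) - level g\<bar> \<le> M"
      using gs(1,2) X Y \<open>0 \<le> M\<close> by (auto simp: level_mult_H level_mult_e)
    then show ?thesis using gs(3) by (auto simp: doubleton_eq_iff abs_minus_commute)
  qed
  assume "(u, w) \<in> connected_avoiding ?\<Gamma> ?S"
  then have "M < level w"
  proof (rule connected_avoiding_invariant[of _ _ _ _ "\<lambda>g. M < level g"])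
    fix a b assume b: "b \<in> verts ?\<Gamma> - ?S" and ab: "{a, b} \<in> edges ?\<Gamma>" and a: "M < level a"
    \<comment> \<open>One edge lowers a level above \<open>M\<close> by at most \<open>M\<close>, so
      it remains positive; outside the strip this means above \<open>M\<close>.\<close>
    have "M < \<bar>level b\<bar>" using b by (auto simp: cayley_graph_def)
    then show "M < level b" using step[OF ab] a by linarith
  qed (rule u)
  with w show False by simp
qed

theorem hamilton_circle_semidirect_int:
  assumes fin: "finite H" and X: "X \<subseteq> H"
    and cyc: "hamilton_cycle (cayley_graph (G\<lparr>carrier := H\<rparr>) X) c"
    and Y: "finite Y" "\<And>y. y \<in> Y \<Longrightarrow> - y \<in> Y" "\<And>d. (\<And>y. y \<in> Y \<Longrightarrow> d dvd y) \<Longrightarrow> d dvd 1"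
  shows "\<exists>C. hamilton_circle (cayley_graph G (X \<union> e ` Y)) C"
proof -
  let ?\<Gamma> = "cayley_graph G (X \<union> e ` Y)"
  obtain D B where D: "bij D" "\<And>j. D (j + 1) - D j \<in> Y" "\<And>j. \<bar>D j - j\<bar> \<le> B"
    using int_hamilton_double_ray[OF Y] by metis
  define n where "n = int (length c)"
  define f where "f = (\<lambda>i. c ! nat i)"
  have n: "3 \<le> n" and dist: "distinct c" and setc: "set c = H"
    and ce: "\<And>i. i < length c \<Longrightarrow>
      {c ! i, c ! (Suc i mod length c)} \<in> edges (cayley_graph (G\<lparr>carrier := H\<rparr>) X)"
    using cyc unfolding hamilton_cycle_def n_def by (auto simp: cayley_graph_def)
  have "bij_betw ((!) c) {..<length c} H"
    by (rule bij_betw_nth[OF dist refl setc[symmetric]])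
  moreover have "bij_betw nat {0..<n} {..<length c}"
    by (rule bij_betwI[of _ _ _ int]) (auto simp: n_def)
  ultimately have "bij_betw ((!) c \<circ> nat) {0..<n} H"
    by (rule bij_betw_trans[rotated])
  then have f: "bij_betw f {0..<n} H"
    by (simp add: f_def comp_def)
  have fH: "f i \<in> H" if "i \<in> {0..<n}" for i
    using bij_betwE[OF f] that by blast
  define v where "v j i = e (D j) \<otimes> f i" for j i
  \<comment> \<open>Right multiplication by the step of \<open>D\<close> leads to the next layer and
    twists the component in \<open>H\<close>; \<open>\<sigma>\<close> expresses this through
    positions on the cycle.\<close>
  define \<sigma> where "\<sigma> = (\<lambda>j i. inv_into {0..<n} f (twist (D (j + 1) - D j) (f i)))"
  have f\<sigma>: "f (\<sigma> j i) = twist (D (j + 1) - D j) (f i)" if "i \<in> {0..<n}" for j i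
    unfolding \<sigma>_def using bij_betw_inv_into_right[OF f twist_closed[OF fH[OF that]]] .
  have cross: "v (j + 1) (\<sigma> j i) = v j i \<otimes> e (D (j + 1) - D j)" if "i \<in> {0..<n}" for j i
  proof -
    have "e (D (j + 1)) = e (D j) \<otimes> e (D (j + 1) - D j)"
      using e_add[of "D j" "D (j + 1) - D j"] by simp
    then show ?thesis
      unfolding v_def f\<sigma>[OF that] using twist_closed[OF fH[OF that]] fH[OF that]
      by (simp add: m_assoc twist_commute)
  qed
  interpret simple_ugraph ?\<Gamma>
    by (rule simple_cayley_graph) (use X in auto)
  interpret layered_ugraph ?\<Gamma> v n \<sigma>
  proof
    show "2 \<le> n" using n by simp
    show "bij_betw (\<lambda>(j, i). v j i) (UNIV \<times> {0..<n}) (verts ?\<Gamma>)"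
      unfolding bij_betw_def
    proof
      show "inj_on (\<lambda>(j, i). v j i) (UNIV \<times> {0..<n})"
      proof (rule inj_onI, clarify)
        fix j i j' i' assume i: "i \<in> {0..<n}" "i' \<in> {0..<n}" and "v j i = v j' i'"
        then have "D j = D j' \<and> f i = f i'"
          unfolding v_def by (intro layer_unique fH)
        then show "j = j' \<and> i = i'"
          using i injD[OF bij_is_inj[OF D(1)]] inj_onD[OF bij_betw_imp_inj_on[OF f]] by blast
      qed
      show "(\<lambda>(j, i). v j i) ` (UNIV \<times> {0..<n}) = verts ?\<Gamma>"
      proof (intro equalityI subsetI)
        fix g assume "g \<in> (\<lambda>(j, i). v j i) ` (UNIV \<times> {0..<n})"
        then show "g \<in> verts ?\<Gamma>"
          using fH by (auto simp: v_def cayley_graph_def)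
      next
        fix g assume "g \<in> verts ?\<Gamma>"
        then have "g \<in> carrier G" by (simp add: cayley_graph_def)
        from layer_decomposition[OF this] obtain k h where kh: "h \<in> H" "g = e k \<otimes> h" by blast
        obtain j where "k = D j" using bij_is_surj[OF D(1)] by blast
        moreover obtain i where "i \<in> {0..<n}" "h = f i"
          using kh(1) bij_betw_imp_surj_on[OF f] by blast
        ultimately show "g \<in> (\<lambda>(j, i). v j i) ` (UNIV \<times> {0..<n})"
          unfolding kh(2) v_def by force
      qed
    qed
    show "{v j i, v j ((i + 1) mod n)} \<in> edges ?\<Gamma>" if i: "i \<in> {0..<n}" for j i
    proof -
      have "f ((i + 1) mod n) = c ! (Suc (nat i) mod length c)"
        using i unfolding f_def n_def by (simp add: nat_mod_distrib Suc_nat_eq_nat_zadd1 add.commute)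
      then have "{f i, f ((i + 1) mod n)} \<in> edges (cayley_graph (G\<lparr>carrier := H\<rparr>) X)"
        using ce[of "nat i"] i unfolding f_def n_def by auto
      then show ?thesis
        unfolding v_def by (intro cayley_graph_translate_subgroup[OF H_subgroup X]) auto
    qed
    show "bij_betw (\<sigma> j) {0..<n} {0..<n}" for j
      using bij_betw_trans[OF bij_betw_trans[OF f bij_twist[of "D (j + 1) - D j"]]
          bij_betw_inv_into[OF f]]
      unfolding \<sigma>_def comp_def .
    show "{v j i, v (j + 1) (\<sigma> j i)} \<in> edges ?\<Gamma>" if i: "i \<in> {0..<n}" for j i
    proof -
      have vc: "v j i \<in> carrier G" using fH[OF i] by (simp add: v_def)
      \<comment> \<open>The Cayley graph has no loops, so the crossing must move its vertex. It
        does, since the level changes.\<close>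
      have "D (j + 1) \<noteq> D j" using injD[OF bij_is_inj[OF D(1)], of "j + 1" j] by auto
      then have "level (v j i \<otimes> e (D (j + 1) - D j)) \<noteq> level (v j i)"
        by (simp add: level_mult_e[OF vc])
      then show ?thesis
        unfolding cross[OF i] using vc D(2) by (intro cayley_graph_edgeI) auto
    qed
  qed
  define M where "M = (\<Sum>y\<in>Y. \<bar>y\<bar>)"
  have M: "\<bar>y\<bar> \<le> M" if "y \<in> Y" for y
    unfolding M_def using that Y(1) by (intro member_le_sum) auto
  have M0: "0 \<le> M" unfolding M_def by (rule sum_nonneg) simp
  show ?thesis
  proof (rule layered_hamilton_circle)
    show "finite {g \<in> carrier G. \<bar>level g\<bar> \<le> M}" by (rule finite_levels[OF fin])
    show "{g \<in> carrier G. \<bar>level g\<bar> \<le> M} \<subseteq> verts ?\<Gamma>" by (auto simp: cayley_graph_def)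
    \<comment> \<open>\<open>B\<close> converts layer numbers into levels:
      \<open>D j \<ge> j - B > M\<close> and \<open>D k \<le> k + B < - M\<close>.\<close>
    fix j k i i' assume jk: "j \<ge> M + B + 1" "k \<le> - (M + B + 1)" and i: "i \<in> {0..<n}" "i' \<in> {0..<n}"
    have "level (v j i) = D j" "level (v k i') = D k"
      unfolding v_def using fH i by (simp_all add: level_eq)
    moreover have "M < D j" "D k \<le> M"
      using D(3)[of j] D(3)[of k] jk M0 by linarith+
    ultimately show "(v j i, v k i') \<notin> connected_avoiding ?\<Gamma> {g \<in> carrier G. \<bar>level g\<bar> \<le> M}"
      by (intro levels_separated[OF X M M0]) simp_all
  qed
qed

end

theorem theorem3p12:
  fixes G :: "('g, 'm) monoid_scheme" (structure)
    and H F X Y :: "'g set"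
  assumes "group G"
    and "semidirect_product G H F"
    and "finite H"
    and "G\<lparr>carrier := F\<rparr> \<cong> integer_group"
    and "finite X" and "symmetric_generating_set (G\<lparr>carrier := H\<rparr>) X"
    and "finite Y" and "symmetric_generating_set (G\<lparr>carrier := F\<rparr>) Y"
    and "\<exists>c. hamilton_cycle (cayley_graph (G\<lparr>carrier := H\<rparr>) X) c"
  shows "\<exists>C. hamilton_circle (cayley_graph G (X \<union> Y)) C"
proof -
  interpret group G by (rule assms(1))
  have HN: "H \<lhd> G" and F: "subgroup F G" and HF: "H <#> F = carrier G" and int: "H \<inter> F = {\<one>}"
    using assms(2) unfolding semidirect_product_def by auto
  interpret FG: group "G\<lparr>carrier := F\<rparr>" by (rule subgroup_imp_group[OF F])
  obtain e where e: "e \<in> iso integer_group (G\<lparr>carrier := F\<rparr>)"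
    using FG.iso_sym[OF assms(4)] unfolding is_iso_def by blast
  have e_bij: "bij_betw e UNIV F" and e_add: "\<And>k l. e (k + l) = e k \<otimes> e l"
    using e by (auto simp: iso_def hom_def integer_group_def)
  have eF: "e k \<in> F" for k using bij_betwE[OF e_bij] by blast
  interpret semidirect_int G H e
  proof (rule semidirect_int.intro[OF assms(1) semidirect_int_axioms.intro])
    show "H \<lhd> G" by (rule HN)
    show "e k \<in> carrier G" for k using eF subgroup.mem_carrier[OF F] by blast
    show "e (k + l) = e k \<otimes> e l" for k l by (rule e_add)
    show "k = 0" if "e k \<in> H" for k
    proof -
      have "e 0 \<otimes> e 0 = e 0" using e_add[of 0 0] by simp
      then have "e 0 = \<one>" using eF subgroup.mem_carrier[OF F] by (metis l_cancel_one')
      moreover have "e k = \<one>" using that eF int by blast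
      ultimately show ?thesis
        using inj_onD[OF bij_betw_imp_inj_on[OF e_bij], of k 0] by simp
    qed
    show "\<exists>h\<in>H. \<exists>k. g = h \<otimes> e k" if g: "g \<in> carrier G" for g
    proof -
      obtain h f where "h \<in> H" "f \<in> F" "g = h \<otimes> f"
        using g unfolding HF[symmetric] set_mult_def by blast
      moreover obtain k where "f = e k"
        using \<open>f \<in> F\<close> bij_betw_imp_surj_on[OF e_bij] by blast
      ultimately show ?thesis by blast
    qed
  qed
  \<comment> \<open>The exponents of the generators in \<open>Y\<close>. Finiteness, symmetry and
    generation are carried over to the integers through \<open>e\<close>.\<close>
  define Z where "Z = e -` Y"
  have YF: "Y \<subseteq> F" and Ygen: "generate (G\<lparr>carrier := F\<rparr>) Y = F"
    and Yinv: "\<And>y. y \<in> Y \<Longrightarrow> inv\<^bsub>G\<lparr>carrier := F\<rparr>\<^esub> y \<in> Y"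
    using assms(8) unfolding symmetric_generating_set_def by auto
  have Y_eq: "Y = e ` Z"
    unfolding Z_def using YF bij_betw_imp_surj_on[OF e_bij] by blast
  have "finite Z"
    unfolding Z_def using assms(7) bij_betw_imp_inj_on[OF e_bij] by (rule finite_vimageI)
  moreover have "- z \<in> Z" if "z \<in> Z" for z
    using that Yinv[of "e z"] m_inv_consistent[OF F eF] unfolding Z_def by (simp add: e_minus)
  moreover have "d dvd 1" if d: "\<And>z. z \<in> Z \<Longrightarrow> d dvd z" for d
  proof -
    \<comment> \<open>The elements whose exponent is divisible by \<open>d\<close> are closed under
      the group operations and contain \<open>Y\<close>, hence they contain
      \<open>e 1\<close>.\<close>
    have "x \<in> e ` {k. d dvd k}" if "x \<in> generate (G\<lparr>carrier := F\<rparr>) Y" for x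
      using that
    proof (induction rule: generate.induct)
      case one
      show ?case using e_0 by (intro image_eqI[of _ _ 0]) simp_all
    next
      case (incl y)
      then show ?case unfolding Y_eq using d by blast
    next
      case (inv y)
      then obtain z where "y = e z" "z \<in> Z" unfolding Y_eq by blast
      then have "inv\<^bsub>G\<lparr>carrier := F\<rparr>\<^esub> y = e (- z)"
        using m_inv_consistent[OF F eF] by (simp add: e_minus)
      moreover have "d dvd - z" using d[OF \<open>z \<in> Z\<close>] by simp
      ultimately show ?case by blast
    next
      case (eng x y)
      then obtain k l where "x = e k" "y = e l" "d dvd k" "d dvd l" by blast
      then have "x \<otimes>\<^bsub>G\<lparr>carrier := F\<rparr>\<^esub> y = e (k + l)" "d dvd k + l"
        by (simp_all add: e_add)
      then show ?case by blast
    qed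
    then have "e 1 \<in> e ` {k. d dvd k}" using Ygen eF by blast
    then show ?thesis
      using inj_image_mem_iff[OF bij_betw_imp_inj_on[OF e_bij]] by blast
  qed
  moreover have "X \<subseteq> H"
    using assms(6) unfolding symmetric_generating_set_def by simp
  ultimately show ?thesis
    unfolding Y_eq using assms(3,9) hamilton_circle_semidirect_int by metis
qed

end
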